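(* Let $X_t$ be a Lévy process on $\mathbb{R}$ with characteristics $A\ge 0$, $\gamma\in\mathbb{R}$ and Lévy measure $d\nu(y)=\nu'(y)\,dy$ on $\mathbb{R}\setminus\{0\}$, and let $L$ be its infinitesimal generator. Suppose there exist constants $C>0$ and $\alpha$ with $0<\alpha<2$, $\alpha\neq 1$, such that $$\nu'(y)\le C|y|^{-\alpha-1},\qquad y\ne 0 .$$ Then $L$ admits the convolution representation $$Lf=\frac{d}{dx}\,S\,\frac{d}{dx}f,\qquad Sg(x)=\frac12 A\,g(x)+\int_{-\infty}^{\infty}k(y-x)\,g(y)\,dy,$$ for $f\in C_0^2$ with compact support, where $k$ is a function satisfying $\int_{-M}^{M}|k(t)|\,dt<\infty$ for every $0<M<\infty$.
   Context: $C_0$ is the Banach space of continuous functions $f$ on $\mathbb{R}$ with $f(x)\to 0$ as $|x|\to\infty$, with the sup norm; $C_0^2$ is the set of $f\in C_0$ with $f',f''\in C_0$. A Lévy process $X_t$ on $\mathbb{R}$ with $X_0=0$ has characteristics $(A,\gamma,\nu)$ if $E\,e^{izX_t}=e^{-t\lambda(z)}$, $t\ge 0$, where $$\lambda(z)=\tfrac12 Az^2-i\gamma z-\int_{-\infty}^{\infty}\bigl(e^{ixz}-1-ixz\,1_{D}(x)\bigr)\,d\nu(x),\qquad D=\{x:|x|\le 1\}.$$ The function $\nu$ is monotonically increasing on each of $(-\infty,0)$ and $(0,\infty)$, differentiable at every $y\ne0$ with derivative $\nu'(y)\ge 0$, normalized by $\nu(y)\to0$ as $y\to\pm\infty$, i.e.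 $\nu(y)=\int_{-\infty}^{y}\nu'(t)\,dt$ for $y<0$ and $\nu(y)=-\int_y^{\infty}\nu'(t)\,dt$ for $y>0$, and $\int_{-\infty}^{\infty}\frac{x^2}{1+x^2}\nu'(x)\,dx<\infty$. The infinitesimal generator $L$ of the semigroup $P_tf(x)=E f(x+X_t)$ on $C_0$ acts on $f\in C_0^2$ by $$Lf(x)=\tfrac12 A f''(x)+\gamma f'(x)+\int_{-\infty}^{\infty}\bigl(f(x+y)-f(x)-y f'(x)1_D(y)\bigr)\nu'(y)\,dy .$$ *)

theory Defs
  imports "HOL-Probability.Probability"
begin

text \<open>\<open>C\<^sub>0\<close> and \<open>C\<^sub>0\<^sup>2\<close> as sets of functions; convergence in the sup norm of \<open>C\<^sub>0\<close>
  is expressed below by \<^const>\<open>uniform_limit\<close> on \<^const>\<open>UNIV\<close>.\<close>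

definition C0 :: "(real \<Rightarrow> real) set" where
  "C0 = {f. continuous_on UNIV f \<and> (f \<longlongrightarrow> 0) at_infinity}"

definition C0_2 :: "(real \<Rightarrow> real) set" where
  "C0_2 = {f. (\<forall>x. f field_differentiable at x) \<and> (\<forall>x. deriv f field_differentiable at x) \<and>
              f \<in> C0 \<and> deriv f \<in> C0 \<and> deriv (deriv f) \<in> C0}"

definition compact_support :: "(real \<Rightarrow> real) \<Rightarrow> bool" where
  "compact_support f \<longleftrightarrow> compact (closure {x. f x \<noteq> 0})"

definition levy_process :: "'a measure \<Rightarrow> (real \<Rightarrow> 'a \<Rightarrow> real) \<Rightarrow> bool" where
  "levy_process M X \<longleftrightarrow>
     prob_space M \<and>
     (\<forall>t\<ge>0. X t \<in> borel_measurable M) \<and>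
     (AE \<omega> in M. X 0 \<omega> = 0) \<and>
     \<comment> \<open>independent increments\<close>
     (\<forall>(n::nat) (s::nat \<Rightarrow> real). 0 \<le> s 0 \<and> strict_mono_on {..n} s \<longrightarrow>
        prob_space.indep_vars M (\<lambda>_. borel) (\<lambda>i \<omega>. X (s (Suc i)) \<omega> - X (s i) \<omega>) {..<n}) \<and>
     \<comment> \<open>stationary increments\<close>
     (\<forall>s\<ge>0. \<forall>t\<ge>0. distr M borel (\<lambda>\<omega>. X (s + t) \<omega> - X s \<omega>) =
        distr M borel (\<lambda>\<omega>. X t \<omega> - X 0 \<omega>)) \<and>
     \<comment> \<open>stochastic continuity\<close>
     (\<forall>t\<ge>0. \<forall>\<epsilon>>0.
        ((\<lambda>s. measure M {\<omega> \<in> space M. \<bar>X s \<omega> - X t \<omega>\<bar> > \<epsilon>}) \<longlongrightarrow> 0) (at t within {0..})) \<and>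
     \<comment> \<open>almost all paths are right-continuous with left limits\<close>
     (AE \<omega> in M. (\<forall>t\<ge>0. continuous (at_right t) (\<lambda>s. X s \<omega>)) \<and>
                  (\<forall>t>0. \<exists>l. ((\<lambda>s. X s \<omega>) \<longlongrightarrow> l) (at_left t)))"

text \<open>The function \<open>\<nu>\<close> that represents the Levy measure \<open>d\<nu>(y) = \<nu>'(y) dy\<close> on the punctured line.
  Its value (and that of \<^term>\<open>deriv \<nu>\<close>) at \<open>0\<close> is arbitrary and irrelevant, as all integrals
  are with respect to Lebesgue measure.\<close>

definition levy_function :: "(real \<Rightarrow> real) \<Rightarrow> bool" where
  "levy_function \<nu> \<longleftrightarrow>
     mono_on {..<0} \<nu> \<and> mono_on {0<..} \<nu> \<and>
     (\<forall>y. y \<noteq> 0 \<longrightarrow> \<nu> field_differentiable at y \<and> deriv \<nu> y \<ge> 0) \<and>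
     (\<nu> \<longlongrightarrow> 0) at_bot \<and> (\<nu> \<longlongrightarrow> 0) at_top \<and>
     (\<forall>y<0. set_integrable lborel {..y} (deriv \<nu>) \<and> \<nu> y = (LBINT t:{..y}. deriv \<nu> t)) \<and>
     (\<forall>y>0. set_integrable lborel {y..} (deriv \<nu>) \<and> \<nu> y = - (LBINT t:{y..}. deriv \<nu> t)) \<and>
     integrable lborel (\<lambda>x. x\<^sup>2 / (1 + x\<^sup>2) * deriv \<nu> x)"

definition levy_exponent :: "real \<Rightarrow> real \<Rightarrow> (real \<Rightarrow> real) \<Rightarrow> real \<Rightarrow> complex" where
  "levy_exponent A \<gamma> \<nu> z =
     of_real (A * z\<^sup>2 / 2) - \<i> * of_real (\<gamma> * z) -
     (LINT x|lborel. (iexp (x * z) - 1 - \<i> * of_real (x * z * indicator {-1..1} x)) *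
        of_real (deriv \<nu> x))"

definition has_levy_characteristics ::
    "'a measure \<Rightarrow> (real \<Rightarrow> 'a \<Rightarrow> real) \<Rightarrow> real \<Rightarrow> real \<Rightarrow> (real \<Rightarrow> real) \<Rightarrow> bool" where
  "has_levy_characteristics M X A \<gamma> \<nu> \<longleftrightarrow>
     A \<ge> 0 \<and> levy_function \<nu> \<and>
     (\<forall>t\<ge>0. \<forall>z. (LINT \<omega>|M. iexp (z * X t \<omega>)) = exp (- of_real t * levy_exponent A \<gamma> \<nu> z))"

definition semigroup_op :: "'a measure \<Rightarrow> (real \<Rightarrow> 'a \<Rightarrow> real) \<Rightarrow> real \<Rightarrow> (real \<Rightarrow> real) \<Rightarrow> real \<Rightarrow> real"
  where "semigroup_op M X t f x = (LINT \<omega>|M. f (x + X t \<omega>))"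

definition generator_graph ::
    "'a measure \<Rightarrow> (real \<Rightarrow> 'a \<Rightarrow> real) \<Rightarrow> ((real \<Rightarrow> real) \<times> (real \<Rightarrow> real)) set" where
  "generator_graph M X =
     {(f, g). f \<in> C0 \<and> g \<in> C0 \<and>
        uniform_limit UNIV (\<lambda>t x. (semigroup_op M X t f x - f x) / t) g (at_right 0)}"

text \<open>Only meaningful for \<^term>\<open>f \<in> Domain (generator_graph M X)\<close>.\<close>

definition generator :: "'a measure \<Rightarrow> (real \<Rightarrow> 'a \<Rightarrow> real) \<Rightarrow> (real \<Rightarrow> real) \<Rightarrow> real \<Rightarrow> real" where
  "generator M X f = (THE g. (f, g) \<in> generator_graph M X)"

definition conv_op :: "real \<Rightarrow> (real \<Rightarrow> real) \<Rightarrow> (real \<Rightarrow> real) \<Rightarrow> real \<Rightarrow> real" where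
  "conv_op A k g x = A / 2 * g x + (LINT y|lborel. k (y - x) * g y)"

end

theory Submission
  imports Defs "HOL-Real_Asymp.Real_Asymp"
begin

text \<open>Write \<open>w\<close> for the Levy density and \<open>D = [-1, 1]\<close>. Two independent facts are needed for \<open>f\<close> of class \<open>C\<^sup>2\<close> with
compact support: that the generator acts on \<open>f\<close> by the integro-differential expression
\<open>L f = A/2 f'' + \<gamma> f' + \<integral> (f(\<cdot> + y) - f - y f' 1\<^sub>D(y)) w(y) dy\<close>, with uniform convergence of the difference quotients
of the semigroup, and that this expression is the derivative of a convolution with \<open>f'\<close>.

For the first fact, only the characteristic functions of the laws \<open>\<mu>\<^sub>t\<close> of \<open>X\<^sub>t\<close> are known. The weight
\<open>1 - sin y / y\<close> is comparable to \<open>min 1 (y\<^sup>2)\<close> and equals the average of \<open>1 - cos (u y)\<close> over \<open>u\<close> in \<open>[0, 1]\<close>.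
Hence the characteristic functions of the finite measures \<open>(1 - sin y / y) \<mu>\<^sub>t(dy) / t\<close> are averages of second differences
of \<open>(e\<^bsup>-t\<lambda>\<^esup> - 1) / t\<close>; these are dominated by \<open>|\<lambda>|\<close> and tend to those of \<open>-\<lambda>\<close>, which belong to the measure
\<open>A/6 \<delta>\<^sub>0 + (1 - sin y / y) w(y) dy\<close>. Levy's continuity theorem yields weak convergence. Now
\<open>f(x + y) - f(x) - f'(x) sin y\<close> divided by the weight is a function of \<open>y\<close> that is bounded and equicontinuous,
uniformly in \<open>x\<close>, because \<open>f''\<close> is uniformly continuous; a Skorohod coupling therefore makes the convergence of
its integrals uniform in \<open>x\<close>. The remaining term \<open>f'(x) \<integral> sin y \<mu>\<^sub>t(dy) / t\<close> is read off from the imaginary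
part of the characteristic function at \<open>1\<close>. The lemma that concludes this part is
\<open>difference_quotient_uniform_limit\<close>.

For the second fact, Taylor's formula with integral remainder writes each integrand
\<open>f(x + y) - f(x) - y f'(x) 1\<^sub>D(y)\<close> as \<open>\<integral> \<Phi>(u, y) f''(x + u) du\<close> for a piecewise linear \<open>\<Phi>\<close>, and the drift is
\<open>\<gamma> f'(x) = \<gamma> \<integral> 1\<^bsub>u \<le> 0\<^esub> f''(x + u) du\<close>. Fubini's theorem then gives
\<open>L f(x) = A/2 f''(x) + \<integral> k(u) f''(x + u) du\<close> with \<open>k(u) = \<integral> \<Phi>(u, y) w(y) dy + \<gamma> 1\<^bsub>u \<le> 0\<^esub>\<close>. The integral of \<open>|\<Phi>(u, y)|\<close> over a
bounded range of \<open>u\<close> is at most a multiple of \<open>min 1 (y\<^sup>2)\<close>, so \<open>k\<close> is locally integrable. As \<open>f'\<close> is Lipschitz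
with compact support, the convolution of \<open>k\<close> with \<open>f'\<close> may be differentiated under the integral
(\<open>convolution_k_f2\<close>, \<open>conv_op_has_derivative\<close>).\<close>

section \<open>Weak convergence, uniformly over equicontinuous test functions\<close>

text \<open>Letting the test function vary with \<open>n\<close> is a way to obtain convergence that is uniform over a family.
In a Skorohod coupling the arguments converge pointwise, equicontinuity at the limit point
makes the difference of the values small whatever the test function is, and dominated convergence applies.\<close>

lemma uniform_weak_convergence_prob:
  fixes \<mu> :: "nat \<Rightarrow> real measure" and \<mu>0 :: "real measure" and g :: "nat \<Rightarrow> real \<Rightarrow> real"
  assumes \<mu>: "\<And>n. real_distribution (\<mu> n)" and \<mu>0: "real_distribution \<mu>0"
    and conv: "weak_conv_m \<mu> \<mu>0"
    and meas [measurable]: "\<And>n. g n \<in> borel_measurable borel"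
    and bound: "\<And>n y. \<bar>g n y\<bar> \<le> B"
    and equi: "\<And>y e. e > 0 \<Longrightarrow> \<exists>d>0. \<forall>y'. \<bar>y' - y\<bar> < d \<longrightarrow> (\<forall>n. \<bar>g n y' - g n y\<bar> < e)"
  shows "(\<lambda>n. (LINT y|\<mu> n. g n y) - (LINT y|\<mu>0. g n y)) \<longlonglongrightarrow> 0"
proof -
  obtain \<Omega> :: "real measure" and Ys Y where \<Omega>: "prob_space \<Omega>"
    and Ys: "\<And>n. Ys n \<in> measurable \<Omega> borel" "\<And>n. distr \<Omega> borel (Ys n) = \<mu> n"
    and Y: "Y \<in> measurable \<Omega> lborel" "distr \<Omega> borel Y = \<mu>0"
    and lim: "\<And>x. x \<in> space \<Omega> \<Longrightarrow> (\<lambda>n. Ys n x) \<longlonglongrightarrow> Y x"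
    using Skorohod[OF \<mu> \<mu>0 conv] by metis
  interpret prob_space \<Omega> by fact
  note [measurable] = Ys(1)
  have [measurable]: "Y \<in> borel_measurable \<Omega>" using Y(1) by simp
  have int: "integrable \<Omega> (\<lambda>x. g n (Ys n x))" "integrable \<Omega> (\<lambda>x. g n (Y x))" for n
    by (auto intro!: integrable_const_bound[where B = B] simp: bound)
  have "(\<lambda>n. LINT x|\<Omega>. g n (Ys n x) - g n (Y x)) \<longlonglongrightarrow> (LINT x|\<Omega>. 0)"
  proof (rule integral_dominated_convergence[where w = "\<lambda>_. 2 * B"])
    show "AE x in \<Omega>. (\<lambda>n. g n (Ys n x) - g n (Y x)) \<longlonglongrightarrow> 0"
    proof (intro AE_I2)
      fix x assume x: "x \<in> space \<Omega>"
      show "(\<lambda>n. g n (Ys n x) - g n (Y x)) \<longlonglongrightarrow> 0"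
      proof (rule LIMSEQ_I)
        fix e :: real assume "e > 0"
        then obtain d where d: "d > 0" "\<And>y' n. \<bar>y' - Y x\<bar> < d \<Longrightarrow> \<bar>g n y' - g n (Y x)\<bar> < e"
          using equi by metis
        obtain N where "\<And>n. n \<ge> N \<Longrightarrow> norm (Ys n x - Y x) < d"
          using LIMSEQ_D[OF lim[OF x] d(1)] by auto
        with d(2) show "\<exists>no. \<forall>n\<ge>no. norm (g n (Ys n x) - g n (Y x) - 0) < e" by auto
      qed
    qed
    show "AE x in \<Omega>. norm (g n (Ys n x) - g n (Y x)) \<le> 2 * B" for n
    proof (intro AE_I2)
      fix x show "norm (g n (Ys n x) - g n (Y x)) \<le> 2 * B"
        using bound[of n "Ys n x"] bound[of n "Y x"] by (simp add: abs_le_iff)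
    qed
  qed auto
  moreover have "(LINT x|\<Omega>. g n (Ys n x) - g n (Y x)) = (LINT y|\<mu> n. g n y) - (LINT y|\<mu>0. g n y)" for n
    unfolding Ys(2)[symmetric] Y(2)[symmetric]
    by (simp add: integral_distr int)
  ultimately show ?thesis by simp
qed

lemma normalised_finite_measure:
  fixes m :: "real measure" and f :: "real \<Rightarrow> 'b::{banach, second_countable_topology}"
  assumes "finite_measure m" and s: "sets m = sets borel" and pos: "measure m UNIV > 0"
  defines "Q \<equiv> density m (\<lambda>_. ennreal (1 / measure m UNIV))"
  shows "real_distribution Q"
    and "f \<in> borel_measurable borel \<Longrightarrow> (LINT y|m. f y) = measure m UNIV *\<^sub>R (LINT y|Q. f y)"
proof -
  interpret finite_measure m by fact
  have sp: "space m = UNIV" using s[THEN sets_eq_imp_space_eq] by simp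
  have "UNIV \<in> sets m" by (simp add: s)
  then have "emeasure Q (space Q) = ennreal (1 / measure m UNIV * measure m UNIV)"
    using pos unfolding Q_def
    by (simp add: emeasure_density sp emeasure_eq_measure flip: ennreal_mult)
  then have "emeasure Q (space Q) = 1" using pos by simp
  then show "real_distribution Q"
    by (intro real_distribution.intro prob_spaceI real_distribution_axioms.intro)
       (simp_all add: Q_def s sp)
  assume f: "f \<in> borel_measurable borel"
  show "(LINT y|m. f y) = measure m UNIV *\<^sub>R (LINT y|Q. f y)"
    unfolding Q_def using pos f
    by (subst integral_density) (simp_all add: measurable_cong_sets[OF s refl])
qed

text \<open>The total masses are the characteristic functions at \<open>0\<close>, so they converge as well. If the limit
has no mass, both integrals vanish in the limit by boundedness; otherwise Levy's continuity theorem applies to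
the normalised measures.\<close>

lemma uniform_levy_continuity:
  fixes m :: "nat \<Rightarrow> real measure" and m0 :: "real measure" and g :: "nat \<Rightarrow> real \<Rightarrow> real"
  assumes m: "\<And>n. finite_measure (m n)" "\<And>n. sets (m n) = sets borel"
    and m0: "finite_measure m0" "sets m0 = sets borel"
    and conv: "\<And>z. (\<lambda>n. char (m n) z) \<longlonglongrightarrow> char m0 z"
    and meas: "\<And>n. g n \<in> borel_measurable borel"
    and bound: "\<And>n y. \<bar>g n y\<bar> \<le> B"
    and equi: "\<And>y e. e > 0 \<Longrightarrow> \<exists>d>0. \<forall>y'. \<bar>y' - y\<bar> < d \<longrightarrow> (\<forall>n. \<bar>g n y' - g n y\<bar> < e)"
  shows "(\<lambda>n. (LINT y|m n. g n y) - (LINT y|m0. g n y)) \<longlonglongrightarrow> 0"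
proof -
  have sp: "space (m n) = UNIV" "space m0 = UNIV" for n
    using m(2)[THEN sets_eq_imp_space_eq] m0(2)[THEN sets_eq_imp_space_eq] by simp_all
  have B: "B \<ge> 0" using bound[of 0 0] by linarith
  define c where "c n = measure (m n) UNIV" for n
  define c0 where "c0 = measure m0 UNIV"
  have c: "c \<longlonglongrightarrow> c0"
    using tendsto_Re[OF conv[of 0]] by (simp add: char_def c_def[abs_def] c0_def sp)
  have bd: "\<bar>LINT y|M. g n y\<bar> \<le> B * measure M UNIV"
    if "finite_measure M" "sets M = sets borel" "space M = UNIV" for M n
  proof -
    interpret finite_measure M by fact
    have "\<bar>LINT y|M. g n y\<bar> \<le> (LINT y|M. B)"
      using meas bound by (intro integral_abs_bound_integral integrable_const_bound[where B=B])
        (auto simp: measurable_cong_sets[OF that(2) refl] B)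
    then show ?thesis by (simp add: that mult.commute)
  qed
  have c_nonneg: "c0 \<ge> 0" by (simp add: c0_def)
  show ?thesis
  proof (cases "c0 = 0")
    case True
    have "(LINT y|m0. g n y) = 0" for n
      using bd[OF m0 sp(2), of n] True by (simp add: c0_def)
    moreover have "(\<lambda>n. LINT y|m n. g n y) \<longlonglongrightarrow> 0"
    proof (rule Lim_null_comparison)
      show "\<forall>\<^sub>F n in sequentially. norm (LINT y|m n. g n y) \<le> B * c n"
        using bd[OF m sp(1)] by (simp add: c_def)
      show "(\<lambda>n. B * c n) \<longlonglongrightarrow> 0" using tendsto_mult[OF tendsto_const[of B] c] True by simp
    qed
    ultimately show ?thesis by simp
  next
    case False
    then have pos: "c0 > 0" using c_nonneg by simp
    \<comment> \<open>Finitely many terms may have no mass; they cannot be normalised and are replaced by \<open>m0\<close>.\<close>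
    define m' where "m' n = (if c n > 0 then m n else m0)" for n
    define Q where "Q M = density M (\<lambda>_. ennreal (1 / measure M UNIV))" for M :: "real measure"
    have ev: "\<forall>\<^sub>F n in sequentially. m' n = m n"
      using order_tendstoD(1)[OF c pos] by eventually_elim (simp add: m'_def)
    have m': "finite_measure (m' n)" "sets (m' n) = sets borel" "measure (m' n) UNIV > 0" for n
      using m m0 pos by (auto simp: m'_def c_def c0_def)
    have c': "(\<lambda>n. measure (m' n) UNIV) \<longlonglongrightarrow> c0"
      by (rule Lim_transform_eventually[OF c]) (use ev in eventually_elim, simp add: c_def)
    have Q: "real_distribution (Q (m' n))" "real_distribution (Q m0)"
      "char (Q (m' n)) z = char (m' n) z / measure (m' n) UNIV" "char (Q m0) z = char m0 z / c0" for n z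
      using normalised_finite_measure(1)[OF m'] normalised_finite_measure(1)[OF m0]
        normalised_finite_measure(2)[OF m', where f = "\<lambda>y. iexp (z * y)"]
        normalised_finite_measure(2)[OF m0, where f = "\<lambda>y. iexp (z * y)"] pos m'(3)[of n]
      by (auto simp: Q_def char_def c0_def scaleR_conv_of_real field_simps)
    have "(\<lambda>n. char (m' n) z) \<longlonglongrightarrow> char m0 z" for z
      by (rule Lim_transform_eventually[OF conv]) (use ev in eventually_elim, simp)
    then have "(\<lambda>n. char (Q (m' n)) z) \<longlonglongrightarrow> char (Q m0) z" for z
      unfolding Q(3,4) using c' pos by (intro tendsto_intros) auto
    then have "weak_conv_m (\<lambda>n. Q (m' n)) (Q m0)"
      by (intro levy_continuity Q)
    then have lim: "(\<lambda>n. (LINT y|Q (m' n). g n y) - (LINT y|Q m0. g n y)) \<longlonglongrightarrow> 0"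
      by (intro uniform_weak_convergence_prob Q meas) (use bound equi in auto)
    interpret Q0: real_distribution "Q m0" by (rule Q)
    have bdQ: "\<bar>LINT y|Q m0. g n y\<bar> \<le> B" for n
      using bd[of "Q m0" n] Q0.prob_space by (simp add: Q0.finite_measure_axioms)
    have "(\<lambda>n. (LINT y|m' n. g n y) - (LINT y|m0. g n y)) \<longlonglongrightarrow> c0 * 0 + 0"
    proof (rule Lim_transform_eventually)
      show "(\<lambda>n. measure (m' n) UNIV * ((LINT y|Q (m' n). g n y) - (LINT y|Q m0. g n y))
              + (measure (m' n) UNIV - c0) * (LINT y|Q m0. g n y)) \<longlonglongrightarrow> c0 * 0 + 0"
      proof (intro tendsto_add tendsto_mult c' lim)
        have "(\<lambda>n. measure (m' n) UNIV - c0) \<longlonglongrightarrow> 0" using c' by (simp add: LIM_zero_iff)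
        moreover have "Bfun (\<lambda>n. LINT y|Q m0. g n y) sequentially"
          using bdQ by (intro BfunI[of _ B]) auto
        ultimately show "(\<lambda>n. (measure (m' n) UNIV - c0) * (LINT y|Q m0. g n y)) \<longlonglongrightarrow> 0"
          using bounded_bilinear.Zfun_prod_Bfun[OF bounded_bilinear_mult] by (simp add: tendsto_Zfun_iff)
      qed
      show "\<forall>\<^sub>F n in sequentially. measure (m' n) UNIV * ((LINT y|Q (m' n). g n y) - (LINT y|Q m0. g n y))
              + (measure (m' n) UNIV - c0) * (LINT y|Q m0. g n y) = (LINT y|m' n. g n y) - (LINT y|m0. g n y)"
        using normalised_finite_measure(2)[OF m' meas] normalised_finite_measure(2)[OF m0 _ meas] pos
        by (simp add: Q_def c0_def algebra_simps)
    qed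
    moreover have "\<forall>\<^sub>F n in sequentially. (LINT y|m' n. g n y) - (LINT y|m0. g n y) =
        (LINT y|m n. g n y) - (LINT y|m0. g n y)"
      using ev by eventually_elim simp
    ultimately show ?thesis by (simp add: tendsto_cong)
  qed
qed

text \<open>The measure \<open>a \<delta>\<^sub>0 + v(y) dy\<close>, realised as an image: one copy of the line carries the mass \<open>a\<close> on
\<open>[0, 1]\<close> and is collapsed to the point \<open>0\<close>, the other one carries the density \<open>v\<close> and is left in place.\<close>

definition add_atom :: "real \<Rightarrow> (real \<Rightarrow> real) \<Rightarrow> real measure" where
  "add_atom a v = distr
     (density (count_space (UNIV :: bool set) \<Otimes>\<^sub>M lborel)
       (\<lambda>p. ennreal (if fst p then a * indicator {0..1} (snd p) else v (snd p))))
     borel (\<lambda>p. if fst p then 0 else snd p)"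

lemma add_atom:
  fixes v :: "real \<Rightarrow> real"
  assumes a: "a \<ge> 0" and v: "integrable lborel v" "\<And>y. v y \<ge> 0"
  shows "sets (add_atom a v) = sets borel" and "finite_measure (add_atom a v)"
    and "\<And>f :: real \<Rightarrow> 'b::{banach, second_countable_topology}.
      f \<in> borel_measurable borel \<Longrightarrow> integrable lborel (\<lambda>y. v y *\<^sub>R f y) \<Longrightarrow>
      (LINT y|add_atom a v. f y) = a *\<^sub>R f 0 + (LINT y|lborel. v y *\<^sub>R f y)"
proof -
  let ?P = "count_space (UNIV :: bool set) \<Otimes>\<^sub>M (lborel :: real measure)"
  let ?h = "\<lambda>p. if fst p then a * indicator {0..1} (snd p) else v (snd p)"
  let ?T = "\<lambda>p. if fst p then 0 else snd p :: real"
  have [measurable]: "v \<in> borel_measurable borel" using v(1) by simp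
  interpret S: pair_sigma_finite "count_space (UNIV :: bool set)" "lborel :: real measure"
    by (intro pair_sigma_finite.intro sigma_finite_measure_count_space_finite sigma_finite_lborel) simp
  have h [measurable]: "?h \<in> borel_measurable ?P" by measurable
  have T [measurable]: "?T \<in> borel_measurable ?P" by measurable
  have h0: "?h p \<ge> 0" for p using a v by auto
  show s: "sets (add_atom a v) = sets borel" by (simp add: add_atom_def)
  have main: "integrable ?P (\<lambda>p. ?h p *\<^sub>R f (?T p)) \<and> 
      integral\<^sup>L ?P (\<lambda>p. ?h p *\<^sub>R f (?T p)) = a *\<^sub>R f 0 + (LINT y|lborel. v y *\<^sub>R f y)"
    if f [measurable]: "f \<in> borel_measurable borel" and vf: "integrable lborel (\<lambda>y. v y *\<^sub>R f y)"
    for f :: "real \<Rightarrow> 'c::{banach, second_countable_topology}"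
  proof -
    have sec: "(\<lambda>y. ?h (b, y) *\<^sub>R f (?T (b, y))) =
        (if b then (\<lambda>y. indicator {0..1} y *\<^sub>R (a *\<^sub>R f 0)) else (\<lambda>y. v y *\<^sub>R f y))" for b
      by (auto simp: fun_eq_iff indicator_def)
    have i: "integrable lborel (\<lambda>y. ?h (b, y) *\<^sub>R f (?T (b, y)))" for b
      unfolding sec using vf by auto
    have I: "integrable ?P (\<lambda>p. ?h p *\<^sub>R f (?T p))"
      by (rule S.Fubini_integrable) (use i in \<open>auto simp: integrable_count_space\<close>)
    have "integral\<^sup>L ?P (\<lambda>p. ?h p *\<^sub>R f (?T p)) = (LINT b|count_space UNIV. LINT y|lborel. ?h (b, y) *\<^sub>R f (?T (b, y)))"
      by (rule S.integral_fst'[OF I, symmetric])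
    also have "\<dots> = (\<Sum>b\<in>UNIV. LINT y|lborel. ?h (b, y) *\<^sub>R f (?T (b, y)))"
      by (rule lebesgue_integral_count_space_finite) simp
    also have "\<dots> = a *\<^sub>R f 0 + (LINT y|lborel. v y *\<^sub>R f y)"
      unfolding sec by (simp add: UNIV_bool)
    finally show ?thesis using I by blast
  qed
  have fin: "integrable ?P ?h"
    using main[of "\<lambda>_. 1 :: real"] v by simp
  have "emeasure (density ?P (\<lambda>p. ennreal (?h p))) (space ?P) = (\<integral>\<^sup>+p. ennreal (?h p) \<partial>?P)"
    by (subst emeasure_density) (auto intro!: nn_integral_cong)
  also have "\<dots> = ennreal (integral\<^sup>L ?P ?h)"
    using fin h0 by (intro nn_integral_eq_integral) auto
  finally have "finite_measure (density ?P (\<lambda>p. ennreal (?h p)))"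
    by (intro finite_measureI) simp
  then show "finite_measure (add_atom a v)"
    unfolding add_atom_def by (intro finite_measure.finite_measure_distr) simp_all
  show "(LINT y|add_atom a v. f y) = a *\<^sub>R f 0 + (LINT y|lborel. v y *\<^sub>R f y)"
    if f [measurable]: "f \<in> borel_measurable borel" and vf: "integrable lborel (\<lambda>y. v y *\<^sub>R f y)"
    for f :: "real \<Rightarrow> 'b::{banach, second_countable_topology}"
    unfolding add_atom_def using main[OF f vf] h0
    by (subst integral_distr, simp, simp, subst integral_density) auto
qed

section \<open>The characteristic exponent and a Fourier-friendly weight\<close>

text \<open>Equality would force \<open>|cos (x/2)| = 1\<close> in \<open>sin x = 2 sin (x/2) cos (x/2)\<close>, and then \<open>sin x = 0\<close>.\<close>

lemma sin_neq_self: "x \<noteq> 0 \<Longrightarrow> sin x \<noteq> (x::real)"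
proof
  assume x: "x \<noteq> 0" "sin x = x"
  have "\<bar>x\<bar> = 2 * \<bar>sin (x/2)\<bar> * \<bar>cos (x/2)\<bar>"
  proof -
    have "x = 2 * sin (x/2) * cos (x/2)" using sin_double[of "x/2"] x by simp
    then show ?thesis by (metis abs_mult abs_numeral)
  qed
  also have "\<dots> \<le> 2 * \<bar>x/2\<bar> * \<bar>cos (x/2)\<bar>"
    by (intro mult_right_mono mult_left_mono abs_sin_x_le_abs_x) auto
  finally have "\<bar>x\<bar> * 1 \<le> \<bar>x\<bar> * \<bar>cos (x/2)\<bar>" by simp
  then have "1 \<le> \<bar>cos (x/2)\<bar>" using x by (simp add: mult_le_cancel_left)
  then have "(cos (x/2))\<^sup>2 \<ge> 1" by (simp add: abs_le_square_iff[of 1, simplified])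
  then have "(sin (x/2))\<^sup>2 \<le> 0" using sin_cos_squared_add[of "x/2"] by linarith
  then have "sin x = 0" using sin_double[of "x/2"] by simp
  with x show False by simp
qed

lemma one_minus_cos_le: "1 - cos x \<le> x\<^sup>2 / (2::real)"
proof -
  have "(sin (x/2))\<^sup>2 \<le> (x/2)\<^sup>2" using abs_sin_x_le_abs_x[of "x/2"] by (rule abs_le_square_iff[THEN iffD1])
  then show ?thesis using cos_double_sin[of "x/2"] by (simp add: power_divide)
qed

text \<open>This weight is of the order of \<open>min 1 (y\<^sup>2)\<close>, which is what a Levy measure can be integrated
against, and it is an average of the functions \<open>1 - cos (u y)\<close>, which makes the Fourier transform of a weighted measure
explicit.\<close>

definition sinc_gap :: "real \<Rightarrow> real" where
  "sinc_gap y = 1 - sinc y"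

lemma sinc_gap_measurable [measurable]: "sinc_gap \<in> borel_measurable borel"
  unfolding sinc_gap_def[abs_def] by measurable

lemma sinc_gap_0 [simp]: "sinc_gap 0 = 0"
  by (simp add: sinc_gap_def)

lemma sinc_gap_mult: "y * sinc_gap y = y - sin y"
  by (simp add: sinc_gap_def field_simps)

lemma sinc_gap_pos: "y \<noteq> 0 \<Longrightarrow> sinc_gap y > 0"
  using sin_x_le_x[of y] sin_x_le_x[of "-y"] sin_neq_self[of y]
  by (cases "y > 0") (auto simp: sinc_gap_def divide_less_eq)

lemma sinc_gap_nonneg: "sinc_gap y \<ge> 0"
  using sinc_gap_pos[of y] by (cases "y = 0") auto

lemma sinc_gap_ge_half: "\<bar>y\<bar> \<ge> 2 \<Longrightarrow> sinc_gap y \<ge> 1/2"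
proof -
  assume y: "\<bar>y\<bar> \<ge> 2"
  have "\<bar>sin y / y\<bar> \<le> 1 / 2"
    using y abs_sin_le_one[of y] unfolding abs_divide by (intro frac_le) auto
  then have "sin y / y \<le> 1 / 2" by linarith
  then show ?thesis using y by (auto simp: sinc_gap_def)
qed

lemma sinc_gap_eq_integral: "sinc_gap y = (LBINT u:{0..1}. 1 - cos (u * y))"
proof (cases "y = 0")
  case False
  have "(LBINT u. (1 - cos (u * y)) * indicator {0..1} u) = (1 - sin (1 * y) / y) - (0 - sin (0 * y) / y)"
    by (rule integral_FTC_Icc_real)
       (use False in \<open>auto intro!: derivative_eq_intros continuous_intros\<close>)
  then show ?thesis using False
    by (simp add: sinc_gap_def set_lebesgue_integral_def mult.commute)
qed (simp add: set_lebesgue_integral_def)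

lemma one_minus_cos_le_min: 
  assumes "\<bar>u\<bar> \<le> 1" shows "1 - cos (u * y) \<le> 2 * min 1 ((y::real)\<^sup>2)"
proof -
  have "(u * y)\<^sup>2 \<le> 1 * y\<^sup>2" unfolding power_mult_distrib
    using assms by (intro mult_right_mono) (auto simp: abs_square_le_1)
  then have "1 - cos (u * y) \<le> 2 * y\<^sup>2" using one_minus_cos_le[of "u * y"] zero_le_power2[of y] by linarith
  moreover have "1 - cos (u * y) \<le> 2" using cos_ge_minus_one[of "u * y"] by linarith
  ultimately show ?thesis by (simp add: min_def)
qed

lemma sinc_gap_le: "sinc_gap y \<le> 2 * min 1 (y\<^sup>2)"
proof -
  have "(LBINT u:{0..1::real}. 1 - cos (u * y)) \<le> (LBINT u:{0..1::real}. 2 * min 1 (y\<^sup>2))"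
    by (rule set_integral_mono)
      (auto intro!: one_minus_cos_le_min borel_integrable_atLeastAtMost' continuous_intros)
  then show ?thesis by (simp add: sinc_gap_eq_integral set_lebesgue_integral_def)
qed

lemma (in pair_sigma_finite) integrable_product_bound:
  fixes F :: "'a \<times> 'b \<Rightarrow> 'c::{banach, second_countable_topology}"
  assumes [measurable]: "F \<in> borel_measurable (M1 \<Otimes>\<^sub>M M2)"
    and a: "integrable M1 a" and b: "integrable M2 b"
    and le: "\<And>x y. norm (F (x, y)) \<le> a x * b y"
  shows "integrable (M1 \<Otimes>\<^sub>M M2) F"
proof (rule Bochner_Integration.integrable_bound)
  have [measurable]: "a \<in> borel_measurable M1" "b \<in> borel_measurable M2" using a b by auto
  show "integrable (M1 \<Otimes>\<^sub>M M2) (\<lambda>p. a (fst p) * b (snd p) :: real)"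
  proof (rule Fubini_integrable)
    show "integrable M1 (\<lambda>x. LINT y|M2. norm (a (fst (x, y)) * b (snd (x, y))))"
      using a by (simp add: abs_mult)
    show "AE x in M1. integrable M2 (\<lambda>y. a (fst (x, y)) * b (snd (x, y)))" using b by simp
  qed measurable
  show "AE p in M1 \<Otimes>\<^sub>M M2. norm (F p) \<le> norm (a (fst p) * b (snd p))"
    using le by (intro AE_I2) (metis abs_ge_self order_trans prod.collapse real_norm_def)
qed fact

text \<open>The measure \<open>\<kappa>\<close> is a Levy measure or a probability measure below; the bound
\<open>1 - cos (u y) \<le> 2 min 1 (y\<^sup>2)\<close> for \<open>|u| \<le> 1\<close> justifies the exchange of the integrals in both cases.\<close>

lemma fourier_sinc_gap:
  fixes \<kappa> :: "real measure"
  assumes "sigma_finite_measure \<kappa>" and s [measurable_cong]: "sets \<kappa> = sets borel"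
    and int: "integrable \<kappa> (\<lambda>y. min 1 (y\<^sup>2))"
  shows "(CLBINT u:{0..1}. (CLINT y|\<kappa>. of_real (1 - cos (u * y)) * iexp (z * y))) =
    (CLINT y|\<kappa>. of_real (sinc_gap y) * iexp (z * y))"
    and "set_integrable lborel {0..1} (\<lambda>u. CLINT y|\<kappa>. of_real (1 - cos (u * y)) * iexp (z * y))"
proof -
  interpret K: sigma_finite_measure \<kappa> by fact
  interpret P: pair_sigma_finite lborel \<kappa> ..
  let ?F = "\<lambda>u y. indicat_real {0..1} u *\<^sub>R (complex_of_real (1 - cos (u * y)) * iexp (z * y))"
  have bound: "norm (?F u y) \<le> indicator {0..1} u * (2 * min 1 (y\<^sup>2))" for u y
  proof -
    have "norm (?F u y) = indicator {0..1} u * (1 - cos (u * y))"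
      unfolding norm_scaleR norm_mult norm_of_real norm_exp_i_times by simp
    then show ?thesis using one_minus_cos_le_min[of u y] by (auto simp: indicator_def)
  qed
  have I: "integrable (lborel \<Otimes>\<^sub>M \<kappa>) (case_prod ?F)"
    by (rule P.integrable_product_bound[where a = "indicator {0..1}" and b = "\<lambda>y. 2 * min 1 (y\<^sup>2)"])
      (use bound int in auto)
  have inner: "(CLBINT u. ?F u y) = of_real (sinc_gap y) * iexp (z * y)" for y
  proof -
    have "(CLBINT u. ?F u y) = (CLBINT u. complex_of_real (indicator {0..1} u * (1 - cos (u * y))) * iexp (z * y))"
      by (intro Bochner_Integration.integral_cong) (auto simp: scaleR_conv_of_real)
    also have "\<dots> = of_real (LBINT u. indicator {0..1} u * (1 - cos (u * y))) * iexp (z * y)"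
      by (simp only: integral_mult_left_zero integral_complex_of_real)
    finally show ?thesis by (simp add: sinc_gap_eq_integral set_lebesgue_integral_def)
  qed
  have "(CLBINT u:{0..1}. (CLINT y|\<kappa>. of_real (1 - cos (u * y)) * iexp (z * y))) = (CLBINT u. (CLINT y|\<kappa>. ?F u y))"
    by (simp add: set_lebesgue_integral_def)
  also have "\<dots> = (CLINT y|\<kappa>. (CLBINT u. ?F u y))"
    by (rule P.Fubini_integral[OF I, symmetric])
  also have "\<dots> = (CLINT y|\<kappa>. of_real (sinc_gap y) * iexp (z * y))"
    by (simp only: inner)
  finally show "(CLBINT u:{0..1}. (CLINT y|\<kappa>. of_real (1 - cos (u * y)) * iexp (z * y))) =
    (CLINT y|\<kappa>. of_real (sinc_gap y) * iexp (z * y))" .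
  show "set_integrable lborel {0..1} (\<lambda>u. CLINT y|\<kappa>. of_real (1 - cos (u * y)) * iexp (z * y))"
    using P.integrable_fst'[OF I] by (simp add: set_integrable_def)
qed

lemma iexp_second_difference:
  "of_real (1 - cos (u * y)) * iexp (z * y) =
     iexp (z * y) - (iexp ((z + u) * y) + iexp ((z - u) * y)) / 2"
proof -
  have "iexp ((z + u) * y) + iexp ((z - u) * y) = iexp (z * y) * (iexp (u * y) + iexp (- (u * y)))"
    by (simp add: distrib_left right_diff_distrib mult_exp_exp algebra_simps)
  also have "iexp (u * y) + iexp (- (u * y)) = 2 * of_real (cos (u * y))"
    by (simp add: complex_eq_iff Re_exp Im_exp)
  finally show ?thesis by (simp add: algebra_simps)
qed

text \<open>The derivative of the exponential has norm at most \<open>1\<close> on the left half-plane, which is convex.\<close>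

lemma norm_exp_minus_1_le:
  fixes x :: complex assumes "Re x \<le> 0" shows "norm (exp x - 1) \<le> norm x"
proof -
  have "norm (exp x - exp 0) \<le> 1 * norm (x - 0)"
  proof (rule field_differentiable_bound[where S = "{x. Re x \<le> 0}" and f = exp and f' = exp])
    show "convex {x. Re x \<le> 0}" by (rule convex_halfspace_Re_le)
    show "(exp has_field_derivative exp z) (at z within {x. Re x \<le> 0})" for z :: complex
      by (rule has_field_derivative_at_within[OF DERIV_exp])
  qed (use assms in auto)
  then show ?thesis by simp
qed

locale levy_triplet =
  fixes A \<gamma> :: real and w :: "real \<Rightarrow> real"
  assumes A_nonneg: "A \<ge> 0"
    and w_measurable [measurable]: "w \<in> borel_measurable borel"
    and w_nonneg: "w y \<ge> 0"
    and w_integrable: "integrable lborel (\<lambda>y. min 1 (y\<^sup>2) * w y)"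
begin

lemma integrable_w:
  fixes h :: "real \<Rightarrow> 'b::{banach, second_countable_topology}"
  assumes [measurable]: "h \<in> borel_measurable borel" and le: "\<And>y. norm (h y) \<le> K * min 1 (y\<^sup>2)"
  shows "integrable lborel (\<lambda>y. w y *\<^sub>R h y)"
proof (rule Bochner_Integration.integrable_bound)
  show "integrable lborel (\<lambda>y. K * (min 1 (y\<^sup>2) * w y))" using w_integrable by simp
  have "norm (w y *\<^sub>R h y) \<le> norm (K * (min 1 (y\<^sup>2) * w y))" for y
    using mult_left_mono[OF le w_nonneg, of y y] w_nonneg[of y] by (simp add: algebra_simps)
  then show "AE y in lborel. norm (w y *\<^sub>R h y) \<le> norm (K * (min 1 (y\<^sup>2) * w y))" by simp
qed simp

definition compensated_iexp :: "real \<Rightarrow> real \<Rightarrow> complex" where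
  "compensated_iexp z y = iexp (y * z) - 1 - \<i> * of_real (y * z * indicator {-1..1} y)"

lemma compensated_iexp_bound: "norm (compensated_iexp z y) \<le> (2 + z\<^sup>2) * min 1 (y\<^sup>2)"
proof (cases "\<bar>y\<bar> \<le> 1")
  case True
  then have i: "indicator {-1..1} y = (1::real)" by (auto simp: indicator_def)
  have "norm (compensated_iexp z y) \<le> \<bar>y * z\<bar> ^ 2 / 2"
    using iexp_approx1[of "y * z" 1] i by (simp add: compensated_iexp_def algebra_simps numeral_2_eq_2)
  also have "\<dots> \<le> (2 + z\<^sup>2) * y\<^sup>2" by (simp add: power_mult_distrib algebra_simps)
  finally show ?thesis using True by (simp add: min_absorb2 abs_square_le_1)
next
  case False
  then have "1 \<le> y\<^sup>2" using abs_square_le_1[of y] by linarith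
  moreover have "norm (compensated_iexp z y) \<le> 2"
    using False norm_triangle_ineq4[of "iexp (y * z)" 1] by (auto simp: compensated_iexp_def indicator_def)
  then have "norm (compensated_iexp z y) \<le> 2 + z\<^sup>2" using zero_le_power2[of z] by linarith
  ultimately show ?thesis by (simp add: min_absorb1)
qed

text \<open>The function \<open>\<lambda>\<close> with \<open>E e\<^bsup>izX(t)\<^esup> = e\<^bsup>-t\<lambda>(z)\<^esup>\<close>.\<close>

definition exponent :: "real \<Rightarrow> complex" where
  "exponent z = of_real (A * z\<^sup>2 / 2) - \<i> * of_real (\<gamma> * z) - (CLBINT y. w y *\<^sub>R compensated_iexp z y)"

lemma exponent_measurable [measurable]: "exponent \<in> borel_measurable borel"
  unfolding exponent_def[abs_def] compensated_iexp_def by measurable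

lemma integrable_compensated_iexp: "integrable lborel (\<lambda>y. w y *\<^sub>R compensated_iexp z y)"
  by (rule integrable_w[OF _ compensated_iexp_bound]) (simp add: compensated_iexp_def)

lemma exponent_bound: "\<exists>K\<ge>0. \<forall>z. \<bar>z\<bar> \<le> b \<longrightarrow> norm (exponent z) \<le> K"
proof -
  define J where "J = (LBINT y. min 1 (y\<^sup>2) * w y)"
  have J: "J \<ge> 0" unfolding J_def by (intro Bochner_Integration.integral_nonneg) (auto simp: w_nonneg)
  have "norm (exponent z) \<le> A * b\<^sup>2 / 2 + \<bar>\<gamma>\<bar> * \<bar>b\<bar> + (2 + b\<^sup>2) * J" if z: "\<bar>z\<bar> \<le> b" for z
  proof -
    have z2: "z\<^sup>2 \<le> b\<^sup>2" using z by (simp add: abs_le_square_iff[symmetric])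
    have "norm (CLBINT y. w y *\<^sub>R compensated_iexp z y) \<le> (LBINT y. (2 + z\<^sup>2) * (min 1 (y\<^sup>2) * w y))"
    proof (intro Bochner_Integration.integral_norm_bound_integral integrable_compensated_iexp)
      show "norm (w y *\<^sub>R compensated_iexp z y) \<le> (2 + z\<^sup>2) * (min 1 (y\<^sup>2) * w y)" for y
        using mult_left_mono[OF compensated_iexp_bound w_nonneg, of y z y] w_nonneg[of y] by (simp add: algebra_simps)
    qed (use w_integrable in simp)
    also have "\<dots> = (2 + z\<^sup>2) * J" by (simp add: J_def)
    also have "\<dots> \<le> (2 + b\<^sup>2) * J" using z2 J by (intro mult_right_mono) auto
    finally have 3: "norm (CLBINT y. w y *\<^sub>R compensated_iexp z y) \<le> (2 + b\<^sup>2) * J" .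
    have 1: "norm (complex_of_real (A * z\<^sup>2 / 2)) \<le> A * b\<^sup>2 / 2"
      using z2 A_nonneg unfolding norm_of_real by (auto simp: mult_left_mono)
    have 2: "norm (\<i> * complex_of_real (\<gamma> * z)) \<le> \<bar>\<gamma>\<bar> * \<bar>b\<bar>"
      using z unfolding norm_mult norm_of_real abs_mult by (auto intro!: mult_left_mono)
    show ?thesis unfolding exponent_def
      by (rule order_trans[OF norm_triangle_ineq4]) (intro add_mono 3 order_trans[OF norm_triangle_ineq4] 1 2)
  qed
  moreover have "0 \<le> A * b\<^sup>2 / 2 + \<bar>\<gamma>\<bar> * \<bar>b\<bar> + (2 + b\<^sup>2) * J" using J A_nonneg by simp
  ultimately show ?thesis by blast
qed

lemma compensated_iexp_second_difference:
  "(compensated_iexp (z + u) y + compensated_iexp (z - u) y) / 2 - compensated_iexp z y = - (of_real (1 - cos (u * y)) * iexp (z * y))"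
  unfolding iexp_second_difference compensated_iexp_def
  by (simp add: algebra_simps diff_divide_distrib add_divide_distrib)

text \<open>The drift and the compensator are linear in \<open>z\<close> and cancel in a symmetric second difference.\<close>

lemma exponent_second_difference:
  "(exponent (z + u) + exponent (z - u)) / 2 - exponent z =
     of_real (A * u\<^sup>2 / 2) + (CLBINT y. w y *\<^sub>R (of_real (1 - cos (u * y)) * iexp (z * y)))"
proof -
  have "(CLBINT y. w y *\<^sub>R (of_real (1 - cos (u * y)) * iexp (z * y))) =
      (CLBINT y. w y *\<^sub>R compensated_iexp z y - (w y *\<^sub>R compensated_iexp (z + u) y + w y *\<^sub>R compensated_iexp (z - u) y) / 2)"
  proof (intro Bochner_Integration.integral_cong refl)
    fix y
    have "of_real (1 - cos (u * y)) * iexp (z * y) = compensated_iexp z y - (compensated_iexp (z + u) y + compensated_iexp (z - u) y) / 2"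
      using compensated_iexp_second_difference[of z u y] by (simp add: algebra_simps)
    then show "w y *\<^sub>R (of_real (1 - cos (u * y)) * iexp (z * y)) =
        w y *\<^sub>R compensated_iexp z y - (w y *\<^sub>R compensated_iexp (z + u) y + w y *\<^sub>R compensated_iexp (z - u) y) / 2"
      by (simp only: scaleR_conv_of_real) (simp add: algebra_simps add_divide_distrib)
  qed
  also have "\<dots> = (CLBINT y. w y *\<^sub>R compensated_iexp z y) - 
      ((CLBINT y. w y *\<^sub>R compensated_iexp (z + u) y) + (CLBINT y. w y *\<^sub>R compensated_iexp (z - u) y)) / 2"
    using integrable_compensated_iexp by simp
  finally have *: "(CLBINT y. w y *\<^sub>R (of_real (1 - cos (u * y)) * iexp (z * y))) = \<dots>" .
  show ?thesis unfolding * unfolding exponent_def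
    by (simp add: field_simps power2_eq_square)
qed

text \<open>The weak limit of the weighted and rescaled laws of the process. The Gaussian part contributes
\<open>A u\<^sup>2 / 2\<close> to a second difference of step \<open>u\<close>, whose average over \<open>u\<close> in \<open>[0, 1]\<close> is the mass \<open>A / 6\<close>.\<close>

definition limit_measure :: "real measure" where
  "limit_measure = add_atom (A / 6) (\<lambda>y. w y * sinc_gap y)"

lemma integrable_w_sinc_gap: "integrable lborel (\<lambda>y. w y * sinc_gap y)"
  using integrable_w[of sinc_gap 2] sinc_gap_le sinc_gap_nonneg by simp

lemma limit_measure:
  shows "sets limit_measure = sets borel" and "finite_measure limit_measure"
    and "\<And>f :: real \<Rightarrow> 'b::{banach, second_countable_topology}.
      f \<in> borel_measurable borel \<Longrightarrow> (\<And>y. norm (f y) \<le> K) \<Longrightarrow>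
      (LINT y|limit_measure. f y) = (A / 6) *\<^sub>R f 0 + (LBINT y. w y *\<^sub>R (sinc_gap y *\<^sub>R f y))"
proof -
  have pre: "A / 6 \<ge> 0" "\<And>y. w y * sinc_gap y \<ge> 0"
    using A_nonneg w_nonneg sinc_gap_nonneg by auto
  note a = add_atom[OF pre(1) integrable_w_sinc_gap pre(2), folded limit_measure_def]
  show "sets limit_measure = sets borel" "finite_measure limit_measure" by (rule a)+
  fix f :: "real \<Rightarrow> 'b::{banach, second_countable_topology}"
  assume [measurable]: "f \<in> borel_measurable borel" and f: "\<And>y. norm (f y) \<le> K"
  have "norm (sinc_gap y *\<^sub>R f y) \<le> 2 * K * min 1 (y\<^sup>2)" for y
    using mult_mono[OF sinc_gap_le f, of y y] sinc_gap_nonneg[of y] by (simp add: algebra_simps)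
  then have "integrable lborel (\<lambda>y. (w y * sinc_gap y) *\<^sub>R f y)"
    using integrable_w[of "\<lambda>y. sinc_gap y *\<^sub>R f y" "2 * K"] by simp
  from a(3)[OF _ this] 
  show "(LINT y|limit_measure. f y) = (A / 6) *\<^sub>R f 0 + (LBINT y. w y *\<^sub>R (sinc_gap y *\<^sub>R f y))"
    by simp
qed

lemma char_limit_measure:
  "char limit_measure z = (CLBINT u:{0..1}. (exponent (z + u) + exponent (z - u)) / 2 - exponent z)"
proof -
  let ?\<kappa> = "density lborel (\<lambda>y. ennreal (w y))"
  have sf: "sigma_finite_measure ?\<kappa>"
    by (subst sigma_finite_measure.sigma_finite_iff_density_finite[OF sigma_finite_lborel]) auto
  have ik: "integrable ?\<kappa> (\<lambda>y. min 1 (y\<^sup>2))"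
    using w_integrable w_nonneg by (subst integrable_density) (auto simp: mult.commute)
  have d: "(CLINT y|?\<kappa>. f y) = (CLBINT y. w y *\<^sub>R f y)" if "f \<in> borel_measurable borel" for f
    using that w_nonneg by (subst integral_density) auto
  have "(CLBINT u:{0..1}. (exponent (z + u) + exponent (z - u)) / 2 - exponent z) =
    (CLBINT u:{0..1}. of_real (A * u\<^sup>2 / 2) + (CLINT y|?\<kappa>. of_real (1 - cos (u * y)) * iexp (z * y)))"
    by (subst d) (auto simp: exponent_second_difference)
  also have "\<dots> = (CLBINT u:{0..1}. complex_of_real (A * u\<^sup>2 / 2)) +
      (CLBINT u:{0..1}. (CLINT y|?\<kappa>. of_real (1 - cos (u * y)) * iexp (z * y)))"
    by (intro set_integral_add fourier_sinc_gap(2) sf ik)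
      (auto intro!: borel_integrable_atLeastAtMost' continuous_intros)
  also have "(CLBINT u:{0..1}. (CLINT y|?\<kappa>. of_real (1 - cos (u * y)) * iexp (z * y))) =
      (CLBINT y. w y *\<^sub>R (of_real (sinc_gap y) * iexp (z * y)))"
    by (subst fourier_sinc_gap(1)[OF sf _ ik]) (auto intro!: d)
  also have "(CLBINT u:{0..1}. complex_of_real (A * u\<^sup>2 / 2)) = of_real (A / 6)"
  proof -
    have "(LBINT u. (A * u\<^sup>2 / 2) * indicator {0..1} u) = A * 1^3 / 6 - A * 0^3 / 6"
      by (rule integral_FTC_Icc_real)
        (auto intro!: derivative_eq_intros continuous_intros simp: power2_eq_square)
    moreover have "(LBINT u:{0..1}. A * u\<^sup>2 / 2) = (LBINT u. (A * u\<^sup>2 / 2) * indicator {0..1} u)"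
      unfolding set_lebesgue_integral_def by (intro Bochner_Integration.integral_cong) auto
    ultimately have "(LBINT u:{0..1}. A * u\<^sup>2 / 2) = A / 6" by simp
    then show ?thesis by (metis set_integral_complex_of_real)
  qed
  also have "of_real (A / 6) + (CLBINT y. w y *\<^sub>R (of_real (sinc_gap y) * iexp (z * y))) = char limit_measure z"
    unfolding char_def by (subst limit_measure(3)[where K = 1]) (auto simp: scaleR_conv_of_real)
  finally show ?thesis by simp
qed

end

section \<open>Compensated difference quotients of compactly supported functions\<close>

text \<open>The value \<open>6\<close> is the limit at \<open>0\<close>, as \<open>1 - sin y / y\<close> behaves like \<open>y\<^sup>2 / 6\<close>.\<close>

definition sinc_gap_ratio :: "real \<Rightarrow> real" where
  "sinc_gap_ratio y = (if y = 0 then 6 else y\<^sup>2 / sinc_gap y)"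

lemma isCont_sinc_gap: "isCont sinc_gap y"
  unfolding sinc_gap_def[abs_def] by (intro continuous_intros isCont_sinc)

lemma isCont_sinc_gap_ratio: "isCont sinc_gap_ratio y"
proof (cases "y = 0")
  case True
  have "((\<lambda>y::real. y\<^sup>2 / (1 - sin y / y)) \<longlongrightarrow> 6) (at 0)" by real_asymp
  then have "(sinc_gap_ratio \<longlongrightarrow> 6) (at 0)"
    by (rule Lim_transform_eventually)
      (auto simp: sinc_gap_ratio_def sinc_gap_def eventually_at_filter)
  then show ?thesis using True by (simp add: isCont_def sinc_gap_ratio_def)
next
  case False
  have "isCont (\<lambda>y. y\<^sup>2 / sinc_gap y) y"
    using sinc_gap_pos[OF False] by (intro continuous_intros isCont_sinc_gap) auto
  moreover have "\<forall>\<^sub>F z in nhds y. sinc_gap_ratio z = z\<^sup>2 / sinc_gap z"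
    using t1_space_nhds[OF False] by eventually_elim (simp add: sinc_gap_ratio_def)
  ultimately show ?thesis by (simp add: isCont_cong)
qed

locale compact_C2 =
  fixes f f1 f2 :: "real \<Rightarrow> real" and R :: real
  assumes f_deriv: "(f has_real_derivative f1 x) (at x)"
    and f1_deriv: "(f1 has_real_derivative f2 x) (at x)"
    and f2_cont: "isCont f2 x"
    and f_supp: "\<bar>x\<bar> > R \<Longrightarrow> f x = 0"
    and R_pos: "R > 0"
begin

lemma f_cont: "isCont f x" and f1_cont: "isCont f1 x"
  using f_deriv f1_deriv DERIV_isCont by blast+

lemma f_f1_f2_measurable [measurable]:
  "f \<in> borel_measurable borel" "f1 \<in> borel_measurable borel" "f2 \<in> borel_measurable borel"
  using f_cont f1_cont f2_cont
  by (auto intro!: borel_measurable_continuous_onI continuous_at_imp_continuous_on)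

lemma deriv_supp:
  fixes h :: "real \<Rightarrow> real" and h' :: real
  assumes h: "\<And>x. \<bar>x\<bar> > R \<Longrightarrow> h x = 0" and d: "(h has_real_derivative h') (at x)" and x: "\<bar>x\<bar> > R"
  shows "h' = 0"
proof -
  have "\<forall>\<^sub>F z in nhds x. h z = 0"
  proof (rule eventually_nhds_in_open[of "{z. \<bar>z\<bar> > R}" x, THEN eventually_mono])
    show "open {z. \<bar>z\<bar> > R}" by (intro open_Collect_less continuous_intros)
  qed (use x h in auto)
  then have "(h has_real_derivative h') (at x) \<longleftrightarrow> ((\<lambda>_. 0) has_real_derivative h') (at x)"
    by (intro DERIV_cong_ev) auto
  with d have "((\<lambda>_. 0) has_real_derivative h') (at x)" by simp
  then show ?thesis using DERIV_unique DERIV_const by blast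
qed

lemma f1_supp: "\<bar>x\<bar> > R \<Longrightarrow> f1 x = 0"
  using deriv_supp[OF f_supp f_deriv] .

lemma f2_supp: "\<bar>x\<bar> > R \<Longrightarrow> f2 x = 0"
  using deriv_supp[OF f1_supp f1_deriv] .

lemma bounded_if_supported:
  fixes h :: "real \<Rightarrow> real"
  assumes h: "\<And>x. \<bar>x\<bar> > R \<Longrightarrow> h x = 0" and c: "\<And>x. isCont h x"
  shows "\<exists>B\<ge>0. \<forall>x. \<bar>h x\<bar> \<le> B"
proof -
  have "compact (h ` {-R..R})"
    by (intro compact_continuous_image continuous_at_imp_continuous_on ballI c compact_Icc)
  then obtain B where B: "\<And>x. x \<in> {-R..R} \<Longrightarrow> \<bar>h x\<bar> \<le> B"
    by (force dest: compact_imp_bounded simp: bounded_real)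
  have "\<bar>h x\<bar> \<le> max 0 B" for x
  proof (cases "\<bar>x\<bar> > R")
    case False
    then have "x \<in> {-R..R}" unfolding atLeastAtMost_iff by linarith
    from B[OF this] show ?thesis by simp
  qed (use h in simp)
  then show ?thesis by (intro exI[of _ "max 0 B"]) auto
qed

lemma common_bound: "\<exists>B\<ge>0. \<forall>x. \<bar>f x\<bar> \<le> B \<and> \<bar>f1 x\<bar> \<le> B \<and> \<bar>f2 x\<bar> \<le> B"
proof -
  obtain B0 B1 B2 where *: "B0 \<ge> 0" "\<And>x. \<bar>f x\<bar> \<le> B0" "B1 \<ge> 0" "\<And>x. \<bar>f1 x\<bar> \<le> B1"
      "B2 \<ge> 0" "\<And>x. \<bar>f2 x\<bar> \<le> B2"
    using bounded_if_supported[OF f_supp f_cont] bounded_if_supported[OF f1_supp f1_cont]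
      bounded_if_supported[OF f2_supp f2_cont] by metis
  have "\<bar>f x\<bar> \<le> B0 + B1 + B2 \<and> \<bar>f1 x\<bar> \<le> B0 + B1 + B2 \<and> \<bar>f2 x\<bar> \<le> B0 + B1 + B2" for x
    using *(1,3,5) *(2,4,6)[of x] by linarith
  then show ?thesis using *(1,3,5) by (intro exI[of _ "B0 + B1 + B2"]) auto
qed

text \<open>A common bound for \<open>|f|\<close>, \<open>|f'|\<close> and \<open>|f''|\<close>.\<close>

definition B :: real where "B = (SOME B. B \<ge> 0 \<and> (\<forall>x. \<bar>f x\<bar> \<le> B \<and> \<bar>f1 x\<bar> \<le> B \<and> \<bar>f2 x\<bar> \<le> B))"

lemma B_nonneg: "B \<ge> 0" and f_bound: "\<bar>f x\<bar> \<le> B" and f1_bound: "\<bar>f1 x\<bar> \<le> B" and f2_bound: "\<bar>f2 x\<bar> \<le> B"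
  using someI_ex[OF common_bound] by (auto simp: B_def)

lemma f2_uniformly_continuous:
  assumes "e > 0"
  shows "\<exists>d>0. \<forall>x y. \<bar>x - y\<bar> < d \<longrightarrow> \<bar>f2 x - f2 y\<bar> < e"
proof -
  have "uniformly_continuous_on {-R-1..R+1} f2"
    by (intro compact_uniformly_continuous continuous_at_imp_continuous_on ballI f2_cont compact_Icc)
  then obtain d where d: "d > 0" 
    "\<And>x y. x \<in> {-R-1..R+1} \<Longrightarrow> y \<in> {-R-1..R+1} \<Longrightarrow> dist y x < d \<Longrightarrow> dist (f2 y) (f2 x) < e"
    using assms unfolding uniformly_continuous_on_def by metis
  show ?thesis
  proof (intro exI[of _ "min d 1"] conjI allI impI)
    fix x y :: real assume *: "\<bar>x - y\<bar> < min d 1"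
    show "\<bar>f2 x - f2 y\<bar> < e"
    proof (cases "x \<in> {-R-1..R+1} \<and> y \<in> {-R-1..R+1}")
      case True
      then show ?thesis using d(2)[of y x] * by (simp add: dist_real_def)
    next
      case False
      then have "\<bar>x\<bar> > R" "\<bar>y\<bar> > R" using * by auto
      then show ?thesis using f2_supp assms by simp
    qed
  qed (use d in simp)
qed

text \<open>The second order Taylor remainder divided by \<open>y\<^sup>2\<close>. The integral form has no singularity at
\<open>y = 0\<close>, and its dependence on \<open>y\<close> is controlled by the modulus of continuity of \<open>f''\<close> alone, uniformly in \<open>x\<close>.\<close>

definition remainder :: "real \<Rightarrow> real \<Rightarrow> real" where
  "remainder x y = integral {0..1} (\<lambda>s. (1 - s) * f2 (x + s * y))"

lemma remainder_integrable: "(\<lambda>s. (1 - s) * f2 (x + s * y)) integrable_on {0..1}"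
  by (intro integrable_continuous_real continuous_at_imp_continuous_on ballI continuous_intros
      isCont_o2[OF _ f2_cont])

lemma taylor: "y\<^sup>2 * remainder x y = f (x + y) - f x - y * f1 x"
proof -
  have "((\<lambda>s. y\<^sup>2 * ((1 - s) * f2 (x + s * y))) has_integral
      ((1 - 1) * y * f1 (x + 1 * y) + f (x + 1 * y)) - ((1 - 0) * y * f1 (x + 0 * y) + f (x + 0 * y))) {0..1}"
  proof (rule fundamental_theorem_of_calculus)
    fix s :: real
    have "((\<lambda>s. (1 - s) * y * f1 (x + s * y) + f (x + s * y)) has_real_derivative
        y\<^sup>2 * ((1 - s) * f2 (x + s * y))) (at s)"
      by (auto intro!: derivative_eq_intros DERIV_chain2[OF f1_deriv] DERIV_chain2[OF f_deriv]
            simp: power2_eq_square algebra_simps)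
    then show "((\<lambda>s. (1 - s) * y * f1 (x + s * y) + f (x + s * y)) has_vector_derivative
        y\<^sup>2 * ((1 - s) * f2 (x + s * y))) (at s within {0..1})"
      by (simp add: has_real_derivative_iff_has_vector_derivative has_vector_derivative_at_within)
  qed simp
  from integral_unique[OF this] show ?thesis by (simp add: remainder_def)
qed

lemma remainder_0: "remainder x 0 = f2 x / 2"
proof -
  have "((\<lambda>s. (1 - s) * f2 x) has_integral (1 - 1\<^sup>2 / 2) * f2 x - (0 - 0\<^sup>2 / 2) * f2 x) {0..1}"
    by (rule fundamental_theorem_of_calculus)
      (auto intro!: derivative_eq_intros simp flip: has_real_derivative_iff_has_vector_derivative)
  from integral_unique[OF this] show ?thesis by (simp add: remainder_def)
qed

lemma remainder_diff:
  assumes le: "\<And>s. s \<in> {0..1} \<Longrightarrow> \<bar>f2 (x + s * y') - f2 (x + s * y)\<bar> \<le> e"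
  shows "\<bar>remainder x y' - remainder x y\<bar> \<le> e"
proof -
  have "remainder x y' - remainder x y =
      integral {0..1} (\<lambda>s. (1 - s) * f2 (x + s * y') - (1 - s) * f2 (x + s * y))"
    unfolding remainder_def by (rule integral_diff[OF remainder_integrable remainder_integrable, symmetric])
  also have "\<bar>\<dots>\<bar> \<le> integral {0..1} (\<lambda>s::real. e)"
    unfolding real_norm_def[symmetric]
  proof (rule Henstock_Kurzweil_Integration.integral_norm_bound_integral)
    show "norm ((1 - s) * f2 (x + s * y') - (1 - s) * f2 (x + s * y)) \<le> e" if s: "s \<in> {0..1}" for s
      using mult_mono[of "1 - s" 1, OF _ le[OF s]] s
      by (simp add: right_diff_distrib[symmetric] abs_mult)
  qed (auto intro!: integrable_diff remainder_integrable)
  finally show ?thesis by simp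
qed

lemma remainder_bound: "\<bar>remainder x y\<bar> \<le> B"
proof -
  have "norm (remainder x y) \<le> integral {0..1} (\<lambda>s::real. B)"
    unfolding remainder_def
  proof (rule Henstock_Kurzweil_Integration.integral_norm_bound_integral[OF remainder_integrable])
    show "norm ((1 - s) * f2 (x + s * y)) \<le> B" if s: "s \<in> {0..1}" for s
      using mult_mono[of "1 - s" 1, OF _ f2_bound] s by (simp add: abs_mult)
  qed auto
  then show ?thesis by simp
qed

lemma remainder_equicontinuous:
  assumes "e > 0" shows "\<exists>d>0. \<forall>x y y'. \<bar>y' - y\<bar> < d \<longrightarrow> \<bar>remainder x y' - remainder x y\<bar> \<le> e"
proof -
  obtain d where d: "d > 0" "\<And>x y. \<bar>x - y\<bar> < d \<Longrightarrow> \<bar>f2 x - f2 y\<bar> < e"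
    using f2_uniformly_continuous[OF assms] by metis
  have "\<bar>remainder x y' - remainder x y\<bar> \<le> e" if y: "\<bar>y' - y\<bar> < d" for x y y'
  proof (rule remainder_diff)
    fix s :: real assume s: "s \<in> {0..1}"
    have "\<bar>s * y' - s * y\<bar> \<le> \<bar>y' - y\<bar>"
      using s mult_right_mono[of s 1 "\<bar>y' - y\<bar>"] by (simp add: right_diff_distrib[symmetric] abs_mult)
    then have "\<bar>(x + s * y') - (x + s * y)\<bar> < d" using y by simp
    from d(2)[OF this] show "\<bar>f2 (x + s * y') - f2 (x + s * y)\<bar> \<le> e" by simp
  qed
  with d(1) show ?thesis by blast
qed

text \<open>The quotient of \<open>f(x + y) - f(x) - f'(x) sin y\<close> by \<open>sinc_gap y\<close>, continued to \<open>y = 0\<close>. It takes this form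
because \<open>y - sin y = y * sinc_gap y\<close>: replacing the compensator \<open>y\<close> of the Taylor remainder by \<open>sin y\<close> costs
exactly \<open>f'(x) y\<close> after the division.\<close>

definition quot :: "real \<Rightarrow> real \<Rightarrow> real" where
  "quot x y = sinc_gap_ratio y * remainder x y + f1 x * y"

lemma sinc_gap_quot: "sinc_gap y * quot x y = f (x + y) - f x - f1 x * sin y"
proof (cases "y = 0")
  case False
  have "sinc_gap y * quot x y = y\<^sup>2 * remainder x y + f1 x * (y * sinc_gap y)"
    using sinc_gap_pos[OF False] False by (simp add: quot_def sinc_gap_ratio_def field_simps)
  then show ?thesis unfolding taylor sinc_gap_mult by (simp add: algebra_simps)
qed simp

lemma quot_0: "quot x 0 = 3 * f2 x"
  by (simp add: quot_def sinc_gap_ratio_def remainder_0)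

lemma quot_nonzero: "y \<noteq> 0 \<Longrightarrow> quot x y = (f (x + y) - f x - f1 x * sin y) / sinc_gap y"
  using sinc_gap_quot[of y x] sinc_gap_pos[of y] by (simp add: field_simps)

text \<open>For \<open>|y| \<le> 2\<close> the defining formula has bounded factors. For larger \<open>|y|\<close> its terms are unbounded
and only their sum is not: there the numerator \<open>f(x + y) - f(x) - f'(x) sin y\<close> is bounded and the weight is at least \<open>1/2\<close>.\<close>

lemma quot_bounded: "\<exists>K\<ge>0. \<forall>x y. \<bar>quot x y\<bar> \<le> K"
proof -
  have "compact (sinc_gap_ratio ` {-2..2})"
    by (intro compact_continuous_image continuous_at_imp_continuous_on ballI isCont_sinc_gap_ratio compact_Icc)
  then obtain Q where Q: "\<And>y. y \<in> {-2..2} \<Longrightarrow> \<bar>sinc_gap_ratio y\<bar> \<le> Q"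
    by (force dest: compact_imp_bounded simp: bounded_real)
  have Q0: "Q \<ge> 0" using Q[of 0] by simp
  have "\<bar>quot x y\<bar> \<le> Q * B + 6 * B" for x y
  proof (cases "\<bar>y\<bar> \<le> 2")
    case True
    have "\<bar>sinc_gap_ratio y * remainder x y\<bar> \<le> Q * B"
      unfolding abs_mult using True Q0 by (intro mult_mono Q remainder_bound) auto
    moreover have "\<bar>f1 x * y\<bar> \<le> B * 2"
      unfolding abs_mult using True B_nonneg by (intro mult_mono f1_bound) auto
    ultimately show ?thesis using B_nonneg unfolding quot_def by linarith
  next
    case False
    then have h: "sinc_gap y \<ge> 1/2" using sinc_gap_ge_half[of y] by simp
    have "\<bar>f1 x * sin y\<bar> \<le> B * 1" unfolding abs_mult using B_nonneg by (intro mult_mono f1_bound) auto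
    moreover have "sinc_gap y * \<bar>quot x y\<bar> = \<bar>f (x + y) - f x - f1 x * sin y\<bar>"
      by (metis sinc_gap_quot abs_mult abs_of_nonneg sinc_gap_nonneg)
    ultimately have "sinc_gap y * \<bar>quot x y\<bar> \<le> 3 * B"
      using f_bound[of x] f_bound[of "x + y"] by linarith
    moreover have "1/2 * \<bar>quot x y\<bar> \<le> sinc_gap y * \<bar>quot x y\<bar>" using h by (intro mult_right_mono) auto
    moreover have "Q * B \<ge> 0" using Q0 B_nonneg by simp
    ultimately show ?thesis by linarith
  qed
  then show ?thesis using Q0 B_nonneg by (intro exI[of _ "Q * B + 6 * B"]) auto
qed

lemma quot_equicontinuous:
  assumes "e > 0" shows "\<exists>d>0. \<forall>y'. \<bar>y' - y\<bar> < d \<longrightarrow> (\<forall>x. \<bar>quot x y' - quot x y\<bar> < e)"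
proof -
  let ?q = "\<bar>sinc_gap_ratio y\<bar>"
  define e1 where "e1 = e / (4 * (?q + 1))"
  define e2 where "e2 = e / (4 * (B + 1))"
  have e12: "e1 > 0" "e2 > 0" using assms B_nonneg by (auto simp: e1_def e2_def)
  obtain d1 where d1: "d1 > 0" "\<And>x y y'. \<bar>y' - y\<bar> < d1 \<Longrightarrow> \<bar>remainder x y' - remainder x y\<bar> \<le> e1"
    using remainder_equicontinuous[OF e12(1)] by metis
  obtain d2 where d2: "d2 > 0" "\<And>y'. \<bar>y' - y\<bar> < d2 \<Longrightarrow> \<bar>sinc_gap_ratio y' - sinc_gap_ratio y\<bar> < e2"
    using isCont_sinc_gap_ratio[of y] e12(2) unfolding continuous_at_eps_delta dist_real_def by metis
  show ?thesis
  proof (intro exI[of _ "min d1 (min d2 e2)"] conjI allI impI)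
    fix y' x assume y': "\<bar>y' - y\<bar> < min d1 (min d2 e2)"
    have "quot x y' - quot x y = (sinc_gap_ratio y' - sinc_gap_ratio y) * remainder x y' +
        sinc_gap_ratio y * (remainder x y' - remainder x y) + f1 x * (y' - y)"
      by (simp add: quot_def algebra_simps)
    moreover have "\<bar>(sinc_gap_ratio y' - sinc_gap_ratio y) * remainder x y'\<bar> \<le> e2 * (B + 1)"
      unfolding abs_mult using d2(2)[of y'] y' remainder_bound[of x y'] e12 by (intro mult_mono) auto
    moreover have "\<bar>sinc_gap_ratio y * (remainder x y' - remainder x y)\<bar> \<le> (?q + 1) * e1"
      unfolding abs_mult using d1(2)[of y' y x] y' by (intro mult_mono) auto
    moreover have "\<bar>f1 x * (y' - y)\<bar> \<le> (B + 1) * e2"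
      unfolding abs_mult using y' f1_bound[of x] B_nonneg by (intro mult_mono) auto
    moreover have "(?q + 1) * e1 = e / 4" "e2 * (B + 1) = e / 4" "(B + 1) * e2 = e / 4"
      using B_nonneg by (auto simp: e1_def e2_def field_simps add_nonneg_eq_0_iff)
    ultimately show "\<bar>quot x y' - quot x y\<bar> < e" using assms by linarith
  qed (use d1 d2 e12 in auto)
qed

lemma quot_measurable [measurable]: "quot x \<in> borel_measurable borel"
proof (intro borel_measurable_continuous_onI continuous_at_imp_continuous_on ballI)
  show "isCont (quot x) y" for y
    unfolding continuous_at_eps_delta dist_real_def using quot_equicontinuous[of _ y] by meson
qed

lemma quot_cont: "isCont (\<lambda>x. quot x y) x"
proof (cases "y = 0")
  case True
  then show ?thesis using f2_cont by (auto simp: quot_0 intro: continuous_intros)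
next
  case False
  then have "(\<lambda>x. quot x y) = (\<lambda>x. (f (x + y) - f x - f1 x * sin y) / sinc_gap y)"
    by (simp add: quot_nonzero)
  moreover have "isCont (\<lambda>x. (f (x + y) - f x - f1 x * sin y) / sinc_gap y) x"
    by (intro continuous_intros isCont_o2[OF _ f_cont] f_cont f1_cont)
      (use sinc_gap_pos[OF False] in simp)
  ultimately show ?thesis by simp
qed

lemma quot_eventually_0: "\<bar>x\<bar> > R + \<bar>y\<bar> \<Longrightarrow> quot x y = 0"
  by (cases "y = 0") (auto simp: quot_0 quot_nonzero f_supp f1_supp f2_supp)

end

lemma C0I_parametrised_integral:
  fixes g :: "real \<Rightarrow> real \<Rightarrow> real"
  assumes "finite_measure N" and [measurable]: "\<And>x. g x \<in> borel_measurable N"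
    and bound: "\<And>x y. \<bar>g x y\<bar> \<le> K"
    and cont: "\<And>x y. isCont (\<lambda>x. g x y) x"
    and vanish: "\<And>x y. \<bar>x\<bar> > R + \<bar>y\<bar> \<Longrightarrow> g x y = 0"
  shows "(\<lambda>x. LINT y|N. g x y) \<in> C0"
proof -
  interpret finite_measure N by fact
  have dct: "(\<lambda>n. LINT y|N. g (X n) y) \<longlonglongrightarrow> (LINT y|N. h y)"
    if "\<And>y. (\<lambda>n. g (X n) y) \<longlonglongrightarrow> h y" "h \<in> borel_measurable N" for X :: "nat \<Rightarrow> real" and h
    by (rule integral_dominated_convergence[where w = "\<lambda>_. K"]) (use that bound in auto)
  have "isCont (\<lambda>x. LINT y|N. g x y) x" for x
    unfolding continuous_at_sequentially comp_def
    by (intro allI impI dct) (use isCont_tendsto_compose[OF cont] in auto)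
  moreover have "((\<lambda>x. LINT y|N. g x y) \<longlongrightarrow> 0) at_infinity"
  proof (rule ccontr)
    assume "\<not> ?thesis"
    then obtain e where "e > 0" and e: "\<forall>b. \<exists>x. \<bar>x\<bar> \<ge> b \<and> \<bar>LINT y|N. g x y\<bar> \<ge> e"
      unfolding Lim_at_infinity by (auto simp: not_less)
    from e have "\<forall>n::nat. \<exists>x. \<bar>x\<bar> \<ge> real n \<and> \<bar>LINT y|N. g x y\<bar> \<ge> e" by blast
    from choice[OF this] obtain X where X: "\<And>n. \<bar>X n\<bar> \<ge> real n" "\<And>n. \<bar>LINT y|N. g (X n) y\<bar> \<ge> e"
      by blast
    have "(\<lambda>n. LINT y|N. g (X n) y) \<longlonglongrightarrow> (LINT y|N. 0)"
    proof (rule dct)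
      fix y
      have "\<forall>\<^sub>F n in sequentially. real n > R + \<bar>y\<bar>" by real_asymp
      then have "\<forall>\<^sub>F n in sequentially. g (X n) y = 0"
      proof eventually_elim
        case (elim n) then show ?case using X(1)[of n] by (intro vanish) linarith
      qed
      then show "(\<lambda>n. g (X n) y) \<longlonglongrightarrow> 0" by (rule tendsto_eventually)
    qed simp
    then have "(\<lambda>n. \<bar>LINT y|N. g (X n) y\<bar>) \<longlonglongrightarrow> 0" by (simp add: tendsto_rabs_zero)
    then have "e \<le> 0" by (rule LIMSEQ_le_const) (use X in auto)
    with \<open>e > 0\<close> show False by simp
  qed
  ultimately show ?thesis by (auto simp: C0_def continuous_at_imp_continuous_on)
qed

section \<open>The generator on compactly supported twice differentiable functions\<close>

text \<open>A family of laws with the characteristic functions of a Levy process. The semigroup of the process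
depends on nothing else, because \<open>P\<^sub>t f(x) = \<integral> f(x + y) \<mu>\<^sub>t(dy)\<close>.\<close>

locale levy_semigroup = levy_triplet +
  fixes \<mu> :: "real \<Rightarrow> real measure"
  assumes law: "t > 0 \<Longrightarrow> real_distribution (\<mu> t)"
    and char_law: "t > 0 \<Longrightarrow> char (\<mu> t) z = exp (- of_real t * exponent z)"
begin

definition rate :: "real \<Rightarrow> real \<Rightarrow> complex" where
  "rate t z = (char (\<mu> t) z - 1) / of_real t"

text \<open>A characteristic function is bounded by \<open>1\<close>, and \<open>|e\<^bsup>-\<lambda>\<^esup>| = e\<^bsup>-Re \<lambda>\<^esup>\<close>.\<close>

lemma Re_exponent_nonneg: "Re (exponent z) \<ge> 0"
proof -
  interpret real_distribution "\<mu> 1" by (rule law) simp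
  have "exp (- Re (exponent z)) \<le> 1"
    using cmod_char_le_1[of z] by (simp add: char_law)
  then show ?thesis by simp
qed

text \<open>This bound, uniform in \<open>t\<close>, is the domination under which averages of \<open>rate t\<close> converge as \<open>t\<close> tends to \<open>0\<close>.\<close>

lemma norm_rate_le: "t > 0 \<Longrightarrow> norm (rate t z) \<le> norm (exponent z)"
proof -
  assume t: "t > 0"
  have "norm (exp (- of_real t * exponent z) - 1) \<le> norm (- of_real t * exponent z)"
    using t Re_exponent_nonneg[of z] by (intro norm_exp_minus_1_le) simp
  then show ?thesis using t by (simp add: rate_def char_law norm_divide norm_mult field_simps)
qed

lemma rate_tendsto:
  assumes t: "\<And>n. t n > 0" "t \<longlonglongrightarrow> 0"
  shows "(\<lambda>n. rate (t n) z) \<longlonglongrightarrow> - exponent z"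
proof -
  have "((\<lambda>s. exp (s * (- exponent z))) has_field_derivative - exponent z) (at 0)"
    by (auto intro!: derivative_eq_intros)
  then have "((\<lambda>s. (exp (s * (- exponent z)) - 1) / s) \<longlongrightarrow> - exponent z) (at 0)"
    by (simp add: has_field_derivative_iff)
  moreover have "filterlim (\<lambda>n. complex_of_real (t n)) (at 0) sequentially"
    using t by (auto simp: filterlim_at less_imp_neq[symmetric] intro!: tendsto_eq_intros)
  ultimately have "(\<lambda>n. (exp (of_real (t n) * (- exponent z)) - 1) / of_real (t n)) \<longlonglongrightarrow> - exponent z"
    by (rule filterlim_compose)
  then show ?thesis by (simp add: rate_def char_law t)
qed

definition scaled_law :: "real \<Rightarrow> real measure" where
  "scaled_law t = density (\<mu> t) (\<lambda>y. ennreal (sinc_gap y / t))"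

lemma scaled_law:
  fixes f :: "real \<Rightarrow> 'b::{banach, second_countable_topology}"
  assumes t: "t > 0"
  shows "sets (scaled_law t) = sets borel" and "finite_measure (scaled_law t)"
    and "f \<in> borel_measurable borel \<Longrightarrow>
      (LINT y|scaled_law t. f y) = (LINT y|\<mu> t. (sinc_gap y / t) *\<^sub>R f y)"
proof -
  interpret real_distribution "\<mu> t" by (rule law) fact
  show "sets (scaled_law t) = sets borel" by (simp add: scaled_law_def)
  have "norm (sinc_gap y / t) \<le> 2 / t" for y
    using t sinc_gap_le[of y] sinc_gap_nonneg[of y]
    by (simp add: divide_right_mono)
  then have int: "integrable (\<mu> t) (\<lambda>y. sinc_gap y / t)"
    by (intro integrable_const_bound[where B = "2 / t"]) auto
  have "emeasure (scaled_law t) (space (scaled_law t)) = (\<integral>\<^sup>+y. ennreal (sinc_gap y / t) \<partial>\<mu> t)"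
    unfolding scaled_law_def by (simp add: emeasure_density)
  also have "\<dots> = ennreal (LINT y|\<mu> t. sinc_gap y / t)"
    using t sinc_gap_nonneg by (intro nn_integral_eq_integral int) auto
  finally show "finite_measure (scaled_law t)" by (intro finite_measureI) simp
  show "(LINT y|scaled_law t. f y) = (LINT y|\<mu> t. (sinc_gap y / t) *\<^sub>R f y)"
    if "f \<in> borel_measurable borel"
    unfolding scaled_law_def using that t sinc_gap_nonneg
    by (subst integral_density) auto
qed

lemma law_one_minus_cos:
  assumes t: "t > 0"
  shows "(CLINT y|\<mu> t. of_real (1 - cos (u * y)) * iexp (z * y)) =
    of_real t * (rate t z - (rate t (z + u) + rate t (z - u)) / 2)"
proof -
  interpret real_distribution "\<mu> t" by (rule law) fact
  have int: "complex_integrable (\<mu> t) (\<lambda>y. iexp (z * y))" for z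
    by (rule integrable_iexp) auto
  have "(CLINT y|\<mu> t. of_real (1 - cos (u * y)) * iexp (z * y)) =
      (CLINT y|\<mu> t. iexp (z * y) - (iexp ((z + u) * y) + iexp ((z - u) * y)) / 2)"
    by (simp only: iexp_second_difference)
  also have "\<dots> = char (\<mu> t) z - (char (\<mu> t) (z + u) + char (\<mu> t) (z - u)) / 2"
    using int[of z] int[of "z + u"] int[of "z - u"] unfolding char_def
    by (simp del: of_real_add of_real_diff of_real_mult)
  also have "\<dots> = of_real t * (rate t z - (rate t (z + u) + rate t (z - u)) / 2)"
    using t by (simp add: rate_def field_simps)
  finally show ?thesis .
qed

lemma char_scaled_law:
  assumes t: "t > 0"
  shows "char (scaled_law t) z = (CLBINT u:{0..1}. rate t z - (rate t (z + u) + rate t (z - u)) / 2)"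
proof -
  interpret real_distribution "\<mu> t" by (rule law) fact
  have int: "integrable (\<mu> t) (\<lambda>y. min 1 (y\<^sup>2))"
    by (intro integrable_const_bound[where B = 1]) auto
  have "char (scaled_law t) z = (CLINT y|\<mu> t. (sinc_gap y / t) *\<^sub>R iexp (z * y))"
    unfolding char_def by (rule scaled_law(3)[OF t]) simp
  also have "\<dots> = (CLINT y|\<mu> t. of_real (sinc_gap y) * iexp (z * y)) / of_real t"
    by (simp add: scaleR_conv_of_real)
  also have "\<dots> = (CLBINT u:{0..1}. (CLINT y|\<mu> t. of_real (1 - cos (u * y)) * iexp (z * y))) / of_real t"
    by (subst fourier_sinc_gap(1)[OF sigma_finite_measure_axioms events_eq_borel int]) simp
  also have "\<dots> = (CLBINT u:{0..1}. rate t z - (rate t (z + u) + rate t (z - u)) / 2)"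
    unfolding law_one_minus_cos[OF t] using t by simp
  finally show ?thesis .
qed

text \<open>Both characteristic functions are averages over \<open>u\<close> in \<open>[0, 1]\<close> of \<open>h(z) - (h(z + u) + h(z - u)) / 2\<close>, with
\<open>h = rate t\<close> for the scaled laws and \<open>h = -\<lambda>\<close> for the limit.\<close>

lemma char_scaled_law_tendsto:
  assumes t: "\<And>n. t n > 0" "t \<longlonglongrightarrow> 0"
  shows "(\<lambda>n. char (scaled_law (t n)) z) \<longlonglongrightarrow> char limit_measure z"
proof -
  obtain K where K: "\<And>y. \<bar>y\<bar> \<le> \<bar>z\<bar> + 1 \<Longrightarrow> norm (exponent y) \<le> K" using exponent_bound by blast
  have [measurable]: "rate (t n) \<in> borel_measurable borel" for n
  proof -
    interpret real_distribution "\<mu> (t n)" by (rule law) (rule t)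
    show ?thesis unfolding rate_def[abs_def] by measurable
  qed
  have "(\<lambda>n. CLBINT u. indicator {0..1} u *\<^sub>R (rate (t n) z - (rate (t n) (z + u) + rate (t n) (z - u)) / 2))
     \<longlonglongrightarrow> (CLBINT u. indicator {0..1} u *\<^sub>R ((exponent (z + u) + exponent (z - u)) / 2 - exponent z))"
  proof (rule integral_dominated_convergence[where w = "\<lambda>u. indicator {0..1} u *\<^sub>R (2 * K)"])
    show "AE u in lborel. (\<lambda>n. indicator {0..1} u *\<^sub>R (rate (t n) z - (rate (t n) (z + u) + rate (t n) (z - u)) / 2))
       \<longlonglongrightarrow> indicator {0..1} u *\<^sub>R ((exponent (z + u) + exponent (z - u)) / 2 - exponent z)"
    proof (intro AE_I2 tendsto_scaleR tendsto_const)
      fix u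
      have "(\<lambda>n. rate (t n) z - (rate (t n) (z + u) + rate (t n) (z - u)) / 2)
          \<longlonglongrightarrow> - exponent z - (- exponent (z + u) + - exponent (z - u)) / 2"
        by (intro tendsto_intros rate_tendsto t) simp
      also have "- exponent z - (- exponent (z + u) + - exponent (z - u)) / 2 = (exponent (z + u) + exponent (z - u)) / 2 - exponent z"
        by (simp add: field_simps)
      finally show "(\<lambda>n. rate (t n) z - (rate (t n) (z + u) + rate (t n) (z - u)) / 2)
          \<longlonglongrightarrow> (exponent (z + u) + exponent (z - u)) / 2 - exponent z" .
    qed
    show "AE u in lborel. norm (indicat_real {0..1} u *\<^sub>R (rate (t n) z - (rate (t n) (z + u) + rate (t n) (z - u)) / 2))
        \<le> indicator {0..1} u *\<^sub>R (2 * K)" for n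
    proof (intro AE_I2)
      fix u :: real
      have r: "norm (rate (t n) y) \<le> K" if "\<bar>y\<bar> \<le> \<bar>z\<bar> + 1" for y
        using norm_rate_le[OF t(1)[of n], of y] K[OF that] by linarith
      show "norm (indicat_real {0..1} u *\<^sub>R (rate (t n) z - (rate (t n) (z + u) + rate (t n) (z - u)) / 2))
        \<le> indicator {0..1} u *\<^sub>R (2 * K)"
      proof (cases "u \<in> {0..1}")
        case True
        have "norm (rate (t n) (z + u) + rate (t n) (z - u)) \<le> K + K"
          by (rule order_trans[OF norm_triangle_ineq], intro add_mono r) (use True in auto)
        then have "norm ((rate (t n) (z + u) + rate (t n) (z - u)) / 2) \<le> K"
          by (simp add: norm_divide)
        then have "norm (rate (t n) z - (rate (t n) (z + u) + rate (t n) (z - u)) / 2) \<le> K + K"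
          by (intro order_trans[OF norm_triangle_ineq4] add_mono r) auto
        then show ?thesis using True by simp
      qed simp
    qed
  qed auto
  then show ?thesis
    by (simp add: char_scaled_law t char_limit_measure set_lebesgue_integral_def)
qed

end

locale levy_generator = levy_semigroup A \<gamma> w \<mu> + compact_C2 f f1 f2 R
  for A \<gamma> w \<mu> f f1 f2 R
begin

text \<open>The integro-differential form of the generator.\<close>

definition L :: "real \<Rightarrow> real" where
  "L x = A / 2 * f2 x + \<gamma> * f1 x +
     (LBINT y. w y * (f (x + y) - f x - y * f1 x * indicator {-1..1} y))"

lemma L_integrand_bound:
  "\<bar>f (x + y) - f x - y * f1 x * indicator {-1..1} y\<bar> \<le> 2 * B * min 1 (y\<^sup>2)"
proof (cases "\<bar>y\<bar> \<le> 1")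
  case True
  then have "indicator {-1..1} y = (1::real)" by (auto simp: indicator_def)
  then have "f (x + y) - f x - y * f1 x * indicator {-1..1} y = y\<^sup>2 * remainder x y"
    by (simp add: taylor)
  moreover have "\<bar>y\<^sup>2 * remainder x y\<bar> \<le> y\<^sup>2 * (2 * B)"
    unfolding abs_mult using remainder_bound[of x y] B_nonneg by (intro mult_mono) auto
  moreover have "min 1 (y\<^sup>2) = y\<^sup>2" using True by (simp add: min_absorb2 abs_square_le_1)
  ultimately show ?thesis by (simp add: mult.commute)
next
  case False
  then have "1 \<le> y\<^sup>2" using abs_square_le_1[of y] by linarith
  moreover have "indicator {-1..1} y = (0::real)" using False by (auto simp: indicator_def)
  moreover have "\<bar>f (x + y) - f x\<bar> \<le> 2 * B" using f_bound[of x] f_bound[of "x + y"] by linarith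
  ultimately show ?thesis by (simp add: min_absorb1)
qed

lemma L_integrable: "integrable lborel (\<lambda>y. w y * (f (x + y) - f x - y * f1 x * indicator {-1..1} y))"
  using integrable_w[of "\<lambda>y. f (x + y) - f x - y * f1 x * indicator {-1..1} y" "2 * B"] L_integrand_bound
  by simp

text \<open>Replacing the compensator \<open>y 1\<^sub>D(y)\<close> by \<open>sin y\<close> turns the integrand into \<open>sinc_gap y * quot x y\<close>. The
difference of the compensators, integrated against the Levy measure, combines with the drift to \<open>-Im \<lambda>(1)\<close>.\<close>

lemma L_eq: "L x = (LINT y|limit_measure. quot x y) - Im (exponent 1) * f1 x"
proof -
  obtain K where K: "\<And>x y. \<bar>quot x y\<bar> \<le> K" using quot_bounded by blast
  have m: "(LINT y|limit_measure. quot x y) = A / 2 * f2 x + (LBINT y. w y * (f (x + y) - f x - f1 x * sin y))"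
    by (subst limit_measure(3)[where K = K]) (simp_all add: K sinc_gap_quot quot_0)
  have Im_compensated_iexp: "Im (compensated_iexp 1 y) = sin y - y * indicator {-1..1} y" for y
    by (simp add: compensated_iexp_def Im_exp)
  have i1: "integrable lborel (\<lambda>y. w y * (sin y - y * indicator {-1..1} y))"
    using integrable_Im[OF integrable_compensated_iexp[of 1]] by (simp add: Im_compensated_iexp)
  have "Im (CLBINT y. w y *\<^sub>R compensated_iexp 1 y) = (LBINT y. w y * (sin y - y * indicator {-1..1} y))"
    by (subst integral_Im[OF integrable_compensated_iexp, symmetric]) (simp add: Im_compensated_iexp)
  then have l: "Im (exponent 1) = - \<gamma> - (LBINT y. w y * (sin y - y * indicator {-1..1} y))"
    by (simp add: exponent_def)
  have eq: "w y * (f (x + y) - f x - f1 x * sin y) =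
      w y * (f (x + y) - f x - y * f1 x * indicator {-1..1} y) - f1 x * (w y * (sin y - y * indicator {-1..1} y))" for y
    by (simp add: algebra_simps)
  have "(LBINT y. w y * (f (x + y) - f x - f1 x * sin y)) =
      (LBINT y. w y * (f (x + y) - f x - y * f1 x * indicator {-1..1} y)) -
      f1 x * (LBINT y. w y * (sin y - y * indicator {-1..1} y))"
    unfolding eq using i1 L_integrable[of x] by simp
  then show ?thesis unfolding m l L_def by (simp add: algebra_simps)
qed

lemma L_C0: "L \<in> C0"
proof -
  obtain K where K: "\<And>x y. \<bar>quot x y\<bar> \<le> K" using quot_bounded by blast
  have [measurable_cong]: "sets limit_measure = sets borel" by (rule limit_measure)
  have 1: "(\<lambda>x. LINT y|limit_measure. quot x y) \<in> C0"
    by (rule C0I_parametrised_integral[where K = K and R = R])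
      (use K quot_cont quot_eventually_0 limit_measure(2) in auto)
  have 2: "(f1 \<longlongrightarrow> 0) at_infinity"
  proof (rule tendsto_eventually)
    show "\<forall>\<^sub>F x in at_infinity. f1 x = 0"
      unfolding eventually_at_infinity using f1_supp by (intro exI[of _ "R + 1"]) auto
  qed
  have "((\<lambda>x. (LINT y|limit_measure. quot x y) - Im (exponent 1) * f1 x) \<longlongrightarrow> 0 - Im (exponent 1) * 0) at_infinity"
    using 1 unfolding C0_def by (intro tendsto_diff tendsto_mult tendsto_const 2) auto
  moreover have "continuous_on UNIV (\<lambda>x. (LINT y|limit_measure. quot x y) - Im (exponent 1) * f1 x)"
    using 1 f1_cont unfolding C0_def
    by (intro continuous_intros continuous_at_imp_continuous_on[of UNIV f1]) auto
  ultimately show ?thesis unfolding C0_def L_eq[abs_def] by simp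
qed

text \<open>The same splitting with compensator \<open>sin y\<close> as for \<open>L\<close>, now for the law at a positive time.\<close>

lemma difference_quotient_eq:
  assumes t: "t > 0"
  shows "((LINT y|\<mu> t. f (x + y)) - f x) / t = (LINT y|scaled_law t. quot x y) + Im (rate t 1) * f1 x"
proof -
  interpret real_distribution "\<mu> t" by (rule law) fact
  have i1: "integrable (\<mu> t) (\<lambda>y. f (x + y))"
    by (intro integrable_const_bound[where B = B]) (use f_bound in auto)
  have i2: "integrable (\<mu> t) (\<lambda>y. sin y)"
    by (intro integrable_const_bound[where B = 1]) auto
  have "Im (char (\<mu> t) 1) = (LINT y|\<mu> t. sin y)"
    unfolding char_def by (subst integral_Im[symmetric]) (auto simp: Im_exp intro!: integrable_iexp)
  then have "Im (rate t 1) = (LINT y|\<mu> t. sin y) / t" by (simp add: rate_def)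
  moreover have "(LINT y|scaled_law t. quot x y) = (LINT y|\<mu> t. (f (x + y) - f x - f1 x * sin y) / t)"
    by (simp add: scaled_law(3)[OF t] sinc_gap_quot)
  moreover have "\<dots> = ((LINT y|\<mu> t. f (x + y)) - f x - f1 x * (LINT y|\<mu> t. sin y)) / t"
    using i1 i2 prob_space by simp
  ultimately show ?thesis by (simp only: diff_divide_distrib) simp
qed

text \<open>If uniformity failed, it would fail along some times \<open>t n\<close> and points \<open>X n\<close>. The functions \<open>quot (X n)\<close> are
uniformly bounded and equicontinuous, so their integrals against \<open>scaled_law (t n)\<close> and \<open>limit_measure\<close> approach each
other.\<close>

lemma difference_quotient_uniform_limit:
  "uniform_limit UNIV (\<lambda>t x. ((LINT y|\<mu> t. f (x + y)) - f x) / t) L (at_right 0)"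
proof (rule uniform_limitI)
  fix e :: real assume e: "e > 0"
  let ?G = "\<lambda>t x. ((LINT y|\<mu> t. f (x + y)) - f x) / t"
  show "\<forall>\<^sub>F t in at_right 0. \<forall>x\<in>UNIV. dist (?G t x) (L x) < e"
  proof (rule sequentially_imp_eventually_at_right[of 0 1])
    fix t :: "nat \<Rightarrow> real" assume t: "\<And>n. 0 < t n" "t \<longlonglongrightarrow> 0"
    \<comment> \<open>\<open>X n\<close> is a point that violates the bound at time \<open>t n\<close>, if there is one.\<close>
    have "\<forall>n. \<exists>x0. dist (?G (t n) x0) (L x0) < e \<longrightarrow> (\<forall>x. dist (?G (t n) x) (L x) < e)"
      by blast
    from choice[OF this] obtain X
      where X: "\<And>n. dist (?G (t n) (X n)) (L (X n)) < e \<Longrightarrow> (\<forall>x. dist (?G (t n) x) (L x) < e)"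
      by blast
    obtain K where K: "\<And>x y. \<bar>quot x y\<bar> \<le> K" using quot_bounded by blast
    have q: "(\<lambda>n. (LINT y|scaled_law (t n). quot (X n) y) - (LINT y|limit_measure. quot (X n) y)) \<longlonglongrightarrow> 0"
    proof (rule uniform_levy_continuity)
      show "\<exists>d>0. \<forall>y'. \<bar>y' - y\<bar> < d \<longrightarrow> (\<forall>n. \<bar>quot (X n) y' - quot (X n) y\<bar> < e)" if "e > 0" for y e
        using quot_equicontinuous[OF that, of y] by blast
    qed (use scaled_law(1,2)[OF t(1)] limit_measure(1,2) char_scaled_law_tendsto[OF t] K in auto)
    have "(\<lambda>n. Im (rate (t n) 1) - (- Im (exponent 1))) \<longlonglongrightarrow> 0"
      by (rule LIM_zero) (use tendsto_Im[OF rate_tendsto[OF t, of 1]] in simp)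
    moreover have "Bfun (\<lambda>n. f1 (X n)) sequentially"
      using f1_bound by (intro BfunI[of _ B]) auto
    ultimately have "(\<lambda>n. (Im (rate (t n) 1) - (- Im (exponent 1))) * f1 (X n)) \<longlonglongrightarrow> 0"
      using bounded_bilinear.Zfun_prod_Bfun[OF bounded_bilinear_mult] by (simp add: tendsto_Zfun_iff)
    moreover have "?G (t n) (X n) - L (X n) =
        (LINT y|scaled_law (t n). quot (X n) y) - (LINT y|limit_measure. quot (X n) y) +
        (Im (rate (t n) 1) - (- Im (exponent 1))) * f1 (X n)" for n
      unfolding difference_quotient_eq[OF t(1)] L_eq by (simp add: algebra_simps)
    ultimately have "(\<lambda>n. ?G (t n) (X n) - L (X n)) \<longlonglongrightarrow> 0"
      using tendsto_add[OF q] by simp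
    from tendstoD[OF this e] have "\<forall>\<^sub>F n in sequentially. dist (?G (t n) (X n)) (L (X n)) < e"
      by (simp add: dist_real_def)
    then show "\<forall>\<^sub>F n in sequentially. \<forall>x\<in>UNIV. dist (?G (t n) x) (L x) < e"
      by eventually_elim (use X in blast)
  qed simp
qed

end

section \<open>The convolution kernel\<close>

context levy_triplet
begin

text \<open>For fixed \<open>y\<close> this is the function \<open>\<Phi>(\<cdot>, y)\<close> with \<open>\<integral> \<Phi>(u, y) f''(x + u) du = f(x + y) - f(x) - y f'(x) 1\<^sub>D(y)\<close>.
For \<open>0 < y \<le> 1\<close> it is the Taylor kernel \<open>(y - u)\<^sup>+\<close> on \<open>u > 0\<close>. For \<open>y > 1\<close> the term \<open>- y f'(x)\<close>
that the Taylor kernel produces has to disappear; as \<open>\<integral> 1\<^bsub>u > 0\<^esub> f''(x + u) du = - f'(x)\<close>, this is achieved by subtracting the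
constant \<open>y\<close> on \<open>u > 0\<close>. Negative \<open>y\<close> are the mirror image.\<close>

definition primitive_kernel :: "real \<Rightarrow> real \<Rightarrow> real" where
  "primitive_kernel u y = (if u * y > 0 then \<bar>y\<bar> * indicator {-1..1} y - min \<bar>u\<bar> \<bar>y\<bar> else 0)"

text \<open>The second summand represents the drift, because \<open>f'(x)\<close> is the integral of \<open>f''(x + u)\<close> over \<open>u \<le> 0\<close>.\<close>

definition k :: "real \<Rightarrow> real" where
  "k u = (LBINT y. w y * primitive_kernel u y) + \<gamma> * indicator {..0} u"

lemma primitive_kernel_measurable [measurable]:
  assumes [measurable]: "g \<in> borel_measurable N" "h \<in> borel_measurable N"
  shows "(\<lambda>x. primitive_kernel (g x) (h x)) \<in> borel_measurable N"
  unfolding primitive_kernel_def by measurable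

lemma k_measurable [measurable]: "k \<in> borel_measurable borel"
  unfolding k_def[abs_def] by measurable

text \<open>For \<open>|y| \<le> 1\<close> the kernel is a triangle of height and base at most \<open>|y|\<close>, so its integral over \<open>u\<close> is of order \<open>y\<^sup>2\<close>.
For \<open>|y| > 1\<close> it is bounded by \<open>|u|\<close>, and its integral over \<open>[-N, N]\<close> is bounded in \<open>y\<close>.\<close>

lemma primitive_kernel_bound:
  assumes "\<bar>u\<bar> \<le> N"
  shows "\<bar>primitive_kernel u y\<bar> \<le> (if \<bar>y\<bar> \<le> 1 then \<bar>y\<bar> * indicator {-\<bar>y\<bar>..\<bar>y\<bar>} u else N * indicator {-N..N} u)"
proof (cases "\<bar>y\<bar> \<le> 1")
  case True
  then have "indicator {-1..1} y = (1::real)" by (auto simp: indicator_def)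
  with True show ?thesis by (auto simp: primitive_kernel_def indicator_def min_def)
next
  case False
  then have "indicator {-1..1} y = (0::real)" by (auto simp: indicator_def)
  with False assms show ?thesis by (auto simp: primitive_kernel_def indicator_def min_def)
qed

text \<open>Integrating over \<open>u\<close> first leaves a function of \<open>y\<close> of order \<open>min 1 (y\<^sup>2) * w y\<close>, which is integrable.\<close>

lemma integrable_pair_kernel:
  fixes h :: "real \<Rightarrow> real"
  assumes [measurable]: "h \<in> borel_measurable borel" and h: "\<And>u. \<bar>h u\<bar> \<le> C" and supp: "\<And>u. \<bar>u\<bar> > N \<Longrightarrow> h u = 0"
    and N: "N > 0"
  shows "integrable (lborel \<Otimes>\<^sub>M lborel) (\<lambda>(y, u). w y * primitive_kernel u y * h u)"
proof -
  have C: "C \<ge> 0" using h[of 0] by linarith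
  define dom :: "real \<Rightarrow> real \<Rightarrow> real" where
    "dom y u = (if \<bar>y\<bar> \<le> 1 then \<bar>y\<bar> * indicator {-\<bar>y\<bar>..\<bar>y\<bar>} u else N * indicator {-N..N} u)" for y u
  have dom_int: "integrable lborel (dom y)" and dom_I: "(LBINT u. dom y u) \<le> (2 + 2 * N\<^sup>2) * min 1 (y\<^sup>2)" for y
  proof -
    show "integrable lborel (dom y)" unfolding dom_def using N by (cases "\<bar>y\<bar> \<le> 1") auto
    show "(LBINT u. dom y u) \<le> (2 + 2 * N\<^sup>2) * min 1 (y\<^sup>2)"
    proof (cases "\<bar>y\<bar> \<le> 1")
      case True
      then have "(LBINT u. dom y u) = 2 * y\<^sup>2"
        by (simp add: dom_def power2_eq_square abs_mult_self_eq)
      also have "\<dots> \<le> (2 + 2 * N\<^sup>2) * y\<^sup>2" by (simp add: algebra_simps)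
      finally show ?thesis using True by (simp add: min_absorb2 abs_square_le_1)
    next
      case False
      then have "1 \<le> y\<^sup>2" using abs_square_le_1[of y] by linarith
      moreover have "(LBINT u. dom y u) = 2 * N\<^sup>2"
        using False N by (simp add: dom_def power2_eq_square)
      ultimately show ?thesis by (simp add: min_absorb1)
    qed
  qed
  have le: "\<bar>w y * primitive_kernel u y * h u\<bar> \<le> (C * w y) * dom y u" for y u
  proof (cases "\<bar>u\<bar> \<le> N")
    case True
    have "\<bar>primitive_kernel u y\<bar> * \<bar>h u\<bar> \<le> dom y u * C"
      using primitive_kernel_bound[OF True, of y] h[of u] unfolding dom_def[symmetric]
      by (intro mult_mono) auto
    from mult_left_mono[OF this w_nonneg[of y]] show ?thesis
      using w_nonneg[of y] by (simp add: abs_mult mult_ac)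
  next
    case False
    have "dom y u \<ge> 0" using N by (auto simp: dom_def)
    then show ?thesis using supp[of u] False C w_nonneg[of y] by simp
  qed
  have inner: "integrable lborel (\<lambda>u. w y * primitive_kernel u y * h u)" for y
  proof (rule Bochner_Integration.integrable_bound)
    show "integrable lborel (\<lambda>u. (C * w y) * dom y u)" using dom_int by simp
    show "AE u in lborel. norm (w y * primitive_kernel u y * h u) \<le> norm ((C * w y) * dom y u)"
      using le[of y] by (intro AE_I2) (smt (verit) real_norm_def)
  qed simp
  have m: "(\<lambda>y. LBINT u. \<bar>w y * primitive_kernel u y * h u\<bar>) \<in> borel_measurable borel"
    by measurable
  show ?thesis
  proof (rule lborel_pair.Fubini_integrable)
    show "integrable lborel (\<lambda>y. LBINT u. norm (case (y, u) of (y, u) \<Rightarrow> w y * primitive_kernel u y * h u))"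
    proof (rule Bochner_Integration.integrable_bound)
      show "integrable lborel (\<lambda>y. (C * (2 + 2 * N\<^sup>2)) * (min 1 (y\<^sup>2) * w y))" using w_integrable by simp
      show "AE y in lborel. norm (LBINT u. norm (case (y, u) of (y, u) \<Rightarrow> w y * primitive_kernel u y * h u))
          \<le> norm ((C * (2 + 2 * N\<^sup>2)) * (min 1 (y\<^sup>2) * w y))"
      proof (intro AE_I2)
        fix y :: real
        have "(LBINT u. \<bar>w y * primitive_kernel u y * h u\<bar>) \<le> (LBINT u. (C * w y) * dom y u)"
          using inner le dom_int by (intro integral_mono integrable_abs) auto
        also have "\<dots> \<le> (C * w y) * ((2 + 2 * N\<^sup>2) * min 1 (y\<^sup>2))"
          using dom_I[of y] C w_nonneg[of y] by (simp add: mult_left_mono)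
        finally have "(LBINT u. \<bar>w y * primitive_kernel u y * h u\<bar>) \<le> (C * (2 + 2 * N\<^sup>2)) * (min 1 (y\<^sup>2) * w y)"
          by (simp add: mult_ac)
        moreover have "(LBINT u. \<bar>w y * primitive_kernel u y * h u\<bar>) \<ge> 0"
          by (intro Bochner_Integration.integral_nonneg) auto
        ultimately show "norm (LBINT u. norm (case (y, u) of (y, u) \<Rightarrow> w y * primitive_kernel u y * h u))
          \<le> norm ((C * (2 + 2 * N\<^sup>2)) * (min 1 (y\<^sup>2) * w y))"
          by simp
      qed
    qed (use m in simp)
    show "AE y in lborel. integrable lborel (\<lambda>u. case (y, u) of (y, u) \<Rightarrow> w y * primitive_kernel u y * h u)"
      using inner by simp
  qed simp
qed

lemma k_locally_integrable:
  assumes N: "N > 0" shows "set_integrable lborel {-N..N} k"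
proof -
  have "integrable (lborel \<Otimes>\<^sub>M lborel) (\<lambda>(y, u). w y * primitive_kernel u y * indicator {-N..N} u)"
    by (rule integrable_pair_kernel[where C = 1 and N = N]) (use N in \<open>auto simp: indicator_def\<close>)
  from lborel_pair.integrable_snd[OF this] have "integrable lborel (\<lambda>u. (LBINT y. w y * primitive_kernel u y) * indicator {-N..N} u)"
    by simp
  moreover have "integrable lborel (\<lambda>u. \<gamma> * indicator {..0} u * indicator {-N..N} u)"
  proof -
    have "integrable lborel (\<lambda>u. \<gamma> * indicator {-N..0} u)" using N by simp
    moreover have "(\<lambda>u. \<gamma> * indicator {..0} u * indicator {-N..N} u) = (\<lambda>u. \<gamma> * indicator {-N..0} u)"
      using N by (auto simp: fun_eq_iff indicator_def)
    ultimately show ?thesis by simp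
  qed
  ultimately have "integrable lborel (\<lambda>u. (LBINT y. w y * primitive_kernel u y) * indicator {-N..N} u
      + \<gamma> * indicator {..0} u * indicator {-N..N} u)"
    by (rule Bochner_Integration.integrable_add)
  then show ?thesis by (simp add: set_integrable_def k_def algebra_simps)
qed

end

context compact_C2
begin

lemma integral_f2_right: "has_bochner_integral lborel (\<lambda>u. f2 (x + u) * indicator {0..} u) (- f1 x)"
  and integral_f2_left: "has_bochner_integral lborel (\<lambda>u. f2 (x + u) * indicator {..0} u) (f1 x)"
proof -
  define S where "S = R + \<bar>x\<bar> + 1"
  have S: "S > 0" "f1 (x + S) = 0" "f1 (x - S) = 0" using R_pos by (auto simp: S_def intro!: f1_supp)
  have D: "((\<lambda>u. f1 (x + u)) has_real_derivative f2 (x + u)) (at u)" for u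
    using f1_deriv[of "u + x"] by (simp add: DERIV_shift add.commute[of x])
  have c: "isCont (\<lambda>u. f2 (x + u)) u" for u by (intro isCont_o2[OF _ f2_cont] continuous_intros)
  have "has_bochner_integral lborel (\<lambda>u. f2 (x + u) * indicator {0..S} u) (f1 (x + S) - f1 (x + 0))"
    by (rule has_bochner_integral_FTC_Icc_real[where F = "\<lambda>u. f1 (x + u)"]) (use S D c in auto)
  moreover have "(\<lambda>u. f2 (x + u) * indicator {0..S} u) = (\<lambda>u. f2 (x + u) * indicator {0..} u)"
    by (auto simp: fun_eq_iff indicator_def S_def intro!: f2_supp)
  ultimately show "has_bochner_integral lborel (\<lambda>u. f2 (x + u) * indicator {0..} u) (- f1 x)"
    using S by simp
  have "has_bochner_integral lborel (\<lambda>u. f2 (x + u) * indicator {-S..0} u) (f1 (x + 0) - f1 (x + (-S)))"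
    by (rule has_bochner_integral_FTC_Icc_real[where F = "\<lambda>u. f1 (x + u)"]) (use S D c in auto)
  moreover have "(\<lambda>u. f2 (x + u) * indicator {-S..0} u) = (\<lambda>u. f2 (x + u) * indicator {..0} u)"
    by (auto simp: fun_eq_iff indicator_def S_def intro!: f2_supp)
  ultimately show "has_bochner_integral lborel (\<lambda>u. f2 (x + u) * indicator {..0} u) (f1 x)"
    using S by simp
qed

text \<open>Difference quotients of \<open>f'\<close> are bounded by the supremum of \<open>|f''|\<close>. For a bounded sequence of increments they vanish
outside one fixed compact interval, on which the kernel is integrable; this is the domination.\<close>

lemma convolution_derivative:
  assumes [measurable]: "k \<in> borel_measurable borel"
    and k: "\<And>N. N > 0 \<Longrightarrow> set_integrable lborel {-N..N} k"
  shows "((\<lambda>x. LBINT u. k u * f1 (x + u)) has_real_derivative (LBINT u. k u * f2 (x + u))) (at x)"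
proof -
  have lip: "\<bar>f1 b - f1 a\<bar> \<le> B * \<bar>b - a\<bar>" for a b
    using field_differentiable_bound[of UNIV f1 f2 B b a] f1_deriv f2_bound by auto
  have int: "integrable lborel (\<lambda>u. k u * f1 (x + u))" for x
  proof (rule Bochner_Integration.integrable_bound)
    show "integrable lborel (\<lambda>u. B * (indicator {-(R+\<bar>x\<bar>)..R+\<bar>x\<bar>} u *\<^sub>R k u))"
      using k[of "R + \<bar>x\<bar>"] R_pos by (simp add: set_integrable_def add_pos_nonneg)
    show "AE u in lborel. norm (k u * f1 (x + u)) \<le> norm (B * (indicator {-(R+\<bar>x\<bar>)..R+\<bar>x\<bar>} u *\<^sub>R k u))"
    proof (intro AE_I2)
      fix u
      show "norm (k u * f1 (x + u)) \<le> norm (B * (indicator {-(R+\<bar>x\<bar>)..R+\<bar>x\<bar>} u *\<^sub>R k u))"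
      proof (cases "\<bar>x + u\<bar> > R")
        case True then show ?thesis using f1_supp by simp
      next
        case False
        then have "u \<in> {-(R+\<bar>x\<bar>)..R+\<bar>x\<bar>}" unfolding atLeastAtMost_iff by linarith
        then show ?thesis using mult_right_mono[OF f1_bound[of "x + u"], of "\<bar>k u\<bar>"] B_nonneg
          by (simp add: abs_mult mult.commute)
      qed
    qed
  qed simp
  have "((\<lambda>h. ((LBINT u. k u * f1 (x + h + u)) - (LBINT u. k u * f1 (x + u))) / h) \<longlongrightarrow> (LBINT u. k u * f2 (x + u))) (at 0)"
    unfolding tendsto_at_iff_sequentially comp_def
  proof (intro allI impI)
    fix X :: "nat \<Rightarrow> real" assume X: "\<forall>i. X i \<in> UNIV - {0}" "X \<longlonglongrightarrow> 0"
    obtain b where b: "b > 0" "\<And>n. \<bar>X n\<bar> \<le> b"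
      using convergent_imp_Bseq[OF convergentI[OF X(2)]] by (auto simp: Bseq_def)
    define N where "N = R + \<bar>x\<bar> + b"
    have N: "N > 0" using R_pos b by (simp add: N_def add_pos_nonneg)
    have "(\<lambda>n. LBINT u. k u * ((f1 (x + X n + u) - f1 (x + u)) / X n)) \<longlonglongrightarrow> (LBINT u. k u * f2 (x + u))"
    proof (rule integral_dominated_convergence[where w = "\<lambda>u. B * \<bar>indicator {-N..N} u *\<^sub>R k u\<bar>"])
      show "AE u in lborel. (\<lambda>n. k u * ((f1 (x + X n + u) - f1 (x + u)) / X n)) \<longlonglongrightarrow> k u * f2 (x + u)"
      proof (intro AE_I2 tendsto_mult tendsto_const)
        fix u
        have "((\<lambda>h. (f1 (x + u + h) - f1 (x + u)) / h) \<longlongrightarrow> f2 (x + u)) (at 0)"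
          using f1_deriv[of "x + u"] by (simp add: DERIV_def)
        then have "((\<lambda>h. (f1 (x + u + h) - f1 (x + u)) / h) \<circ> X) \<longlonglongrightarrow> f2 (x + u)"
          unfolding tendsto_at_iff_sequentially using X by blast
        then show "(\<lambda>n. (f1 (x + X n + u) - f1 (x + u)) / X n) \<longlonglongrightarrow> f2 (x + u)"
          by (simp add: comp_def add_ac)
      qed
      show "integrable lborel (\<lambda>u. B * \<bar>indicator {-N..N} u *\<^sub>R k u\<bar>)"
        using k[OF N] unfolding set_integrable_def by (intro integrable_mult_right integrable_abs)
      show "AE u in lborel. norm (k u * ((f1 (x + X n + u) - f1 (x + u)) / X n)) \<le> B * \<bar>indicator {-N..N} u *\<^sub>R k u\<bar>" for n
      proof (intro AE_I2)
        fix u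
        show "norm (k u * ((f1 (x + X n + u) - f1 (x + u)) / X n)) \<le> B * \<bar>indicator {-N..N} u *\<^sub>R k u\<bar>"
        proof (cases "u \<in> {-N..N}")
          case True
          have "\<bar>(f1 (x + X n + u) - f1 (x + u)) / X n\<bar> \<le> B"
            using lip[of "x + X n + u" "x + u"] X(1)[rule_format, of n] by (simp add: abs_divide divide_le_eq)
          then have "\<bar>k u\<bar> * \<bar>(f1 (x + X n + u) - f1 (x + u)) / X n\<bar> \<le> \<bar>k u\<bar> * B"
            by (rule mult_left_mono) simp
          then show ?thesis using True by (simp add: abs_mult mult.commute)
        next
          case False
          then have "\<bar>x + X n + u\<bar> > R" "\<bar>x + u\<bar> > R"
            using b(2)[of n] b(1) unfolding N_def atLeastAtMost_iff by linarith+
          then show ?thesis using f1_supp B_nonneg by simp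
        qed
      qed
    qed auto
    moreover have "(LBINT u. k u * ((f1 (x + X n + u) - f1 (x + u)) / X n)) =
        ((LBINT u. k u * f1 (x + X n + u)) - (LBINT u. k u * f1 (x + u))) / X n" for n
    proof -
      have "(LBINT u. k u * ((f1 (x + X n + u) - f1 (x + u)) / X n)) =
          (LBINT u. (k u * f1 (x + X n + u) - k u * f1 (x + u)) / X n)"
        by (simp add: right_diff_distrib)
      also have "\<dots> = ((LBINT u. k u * f1 (x + X n + u)) - (LBINT u. k u * f1 (x + u))) / X n"
        using int[of "x + X n"] int[of x] by simp
      finally show ?thesis .
    qed
    ultimately show "(\<lambda>n. ((LBINT u. k u * f1 (x + X n + u)) - (LBINT u. k u * f1 (x + u))) / X n)
        \<longlonglongrightarrow> (LBINT u. k u * f2 (x + u))"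
      by (simp only:)
  qed
  then show ?thesis by (simp add: DERIV_def)
qed

end

context levy_generator
begin

lemma primitive_kernel_integral:
  "(LBINT u. primitive_kernel u y * f2 (x + u)) = f (x + y) - f x - y * f1 x * indicator {-1..1} y"
proof -
  let ?i = "indicator {-1..1} y :: real"
  consider "y = 0" | "y > 0" | "y < 0" by linarith
  then show ?thesis
  proof cases
    case 1 then show ?thesis by (simp add: primitive_kernel_def)
  next
    case 2
    have "has_bochner_integral lborel (\<lambda>u. ((y - u) * f2 (x + u)) * indicator {0..y} u)
        (((y - y) * f1 (x + y) + f (x + y)) - ((y - 0) * f1 (x + 0) + f (x + 0)))"
      by (rule has_bochner_integral_FTC_Icc_real[where F = "\<lambda>u. (y - u) * f1 (x + u) + f (x + u)"])
        (use 2 in \<open>auto intro!: derivative_eq_intros DERIV_chain2[OF f1_deriv] DERIV_chain2[OF f_deriv]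
          continuous_intros isCont_o2[OF _ f2_cont]\<close>)
    from has_bochner_integral_diff[OF this has_bochner_integral_mult_right[OF integral_f2_right[of x], of "y * (1 - ?i)"]]
    have "has_bochner_integral lborel (\<lambda>u. ((y - u) * f2 (x + u)) * indicator {0..y} u -
         y * (1 - ?i) * (f2 (x + u) * indicator {0..} u)) (f (x + y) - f x - y * f1 x * ?i)"
      by (simp add: algebra_simps)
    from has_bochner_integral_integral_eq[OF this]
    have "(LBINT u. ((y - u) * f2 (x + u)) * indicator {0..y} u -
         y * (1 - ?i) * (f2 (x + u) * indicator {0..} u)) = f (x + y) - f x - y * f1 x * ?i" .
    moreover have "(LBINT u. primitive_kernel u y * f2 (x + u)) = (LBINT u. ((y - u) * f2 (x + u)) * indicator {0..y} u -
         y * (1 - ?i) * (f2 (x + u) * indicator {0..} u))"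
    proof (rule integral_cong_AE)
      \<comment> \<open>The two sides differ only at \<open>u = 0\<close>.\<close>
      show "AE u in lborel. primitive_kernel u y * f2 (x + u) = ((y - u) * f2 (x + u)) * indicator {0..y} u -
         y * (1 - ?i) * (f2 (x + u) * indicator {0..} u)"
        using AE_lborel_singleton[of 0]
      proof eventually_elim
        case (elim u)
        then show ?case using 2
          by (cases "u > 0"; cases "u \<le> y") (auto simp: primitive_kernel_def zero_less_mult_iff min_def algebra_simps)
      qed
    qed simp_all
    ultimately show ?thesis by simp
  next
    case 3
    have "has_bochner_integral lborel (\<lambda>u. ((u - y) * f2 (x + u)) * indicator {y..0} u)
        (((0 - y) * f1 (x + 0) - f (x + 0)) - ((y - y) * f1 (x + y) - f (x + y)))"
      by (rule has_bochner_integral_FTC_Icc_real[where F = "\<lambda>u. (u - y) * f1 (x + u) - f (x + u)"])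
        (use 3 in \<open>auto intro!: derivative_eq_intros DERIV_chain2[OF f1_deriv] DERIV_chain2[OF f_deriv]
          continuous_intros isCont_o2[OF _ f2_cont]\<close>)
    from has_bochner_integral_add[OF this has_bochner_integral_mult_right[OF integral_f2_left[of x], of "y * (1 - ?i)"]]
    have "has_bochner_integral lborel (\<lambda>u. ((u - y) * f2 (x + u)) * indicator {y..0} u +
         y * (1 - ?i) * (f2 (x + u) * indicator {..0} u)) (f (x + y) - f x - y * f1 x * ?i)"
      by (simp add: algebra_simps)
    from has_bochner_integral_integral_eq[OF this]
    have "(LBINT u. ((u - y) * f2 (x + u)) * indicator {y..0} u +
         y * (1 - ?i) * (f2 (x + u) * indicator {..0} u)) = f (x + y) - f x - y * f1 x * ?i" .
    moreover have "(LBINT u. primitive_kernel u y * f2 (x + u)) = (LBINT u. ((u - y) * f2 (x + u)) * indicator {y..0} u +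
         y * (1 - ?i) * (f2 (x + u) * indicator {..0} u))"
    proof (rule integral_cong_AE)
      show "AE u in lborel. primitive_kernel u y * f2 (x + u) = ((u - y) * f2 (x + u)) * indicator {y..0} u +
         y * (1 - ?i) * (f2 (x + u) * indicator {..0} u)"
        using AE_lborel_singleton[of 0]
      proof eventually_elim
        case (elim u)
        then show ?case using 3
          by (cases "u < 0"; cases "u \<ge> y") (auto simp: primitive_kernel_def zero_less_mult_iff min_def algebra_simps)
      qed
    qed simp_all
    ultimately show ?thesis by simp
  qed
qed

lemma convolution_k_f2: "(LBINT u. k u * f2 (x + u)) = L x - A / 2 * f2 x"
proof -
  have I: "integrable (lborel \<Otimes>\<^sub>M lborel) (\<lambda>(y, u). w y * primitive_kernel u y * f2 (x + u))"
    by (rule integrable_pair_kernel[where C = B and N = "R + \<bar>x\<bar>"])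
      (use R_pos f2_bound in \<open>auto intro!: f2_supp\<close>)
  have i1: "integrable lborel (\<lambda>u. (LBINT y. w y * primitive_kernel u y) * f2 (x + u))"
    using lborel_pair.integrable_snd[OF I] by simp
  have "(LBINT u. (LBINT y. w y * primitive_kernel u y) * f2 (x + u)) =
      (LBINT u. (LBINT y. w y * primitive_kernel u y * f2 (x + u)))"
    by simp
  also have "\<dots> = (LBINT y. (LBINT u. w y * primitive_kernel u y * f2 (x + u)))"
    by (rule lborel_pair.Fubini_integral[OF I])
  also have "\<dots> = (LBINT y. w y * (f (x + y) - f x - y * f1 x * indicator {-1..1} y))"
    by (simp add: mult.assoc primitive_kernel_integral)
  finally have 1: "(LBINT u. (LBINT y. w y * primitive_kernel u y) * f2 (x + u)) = \<dots>" .
  have "(LBINT u. k u * f2 (x + u)) =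
      (LBINT u. (LBINT y. w y * primitive_kernel u y) * f2 (x + u) + \<gamma> * (f2 (x + u) * indicator {..0} u))"
    by (simp add: k_def algebra_simps)
  also have "\<dots> = (LBINT y. w y * (f (x + y) - f x - y * f1 x * indicator {-1..1} y)) + \<gamma> * f1 x"
    using i1 integral_f2_left[of x] 1 by (simp add: has_bochner_integral_iff)
  finally show ?thesis by (simp add: L_def)
qed

lemma conv_op_has_derivative: "(conv_op A k f1 has_real_derivative L x) (at x)"
proof -
  have shift: "(LBINT y. k (y - x) * f1 y) = (LBINT u. k u * f1 (x + u))" for x
    using lborel_integral_real_affine[of 1 "\<lambda>y. k (y - x) * f1 y" x] by simp
  have "((\<lambda>x. A / 2 * f1 x + (LBINT u. k u * f1 (x + u))) has_real_derivative
      A / 2 * f2 x + (LBINT u. k u * f2 (x + u))) (at x)"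
    by (intro derivative_intros DERIV_cmult f1_deriv convolution_derivative k_measurable k_locally_integrable)
  then show ?thesis unfolding convolution_k_f2 conv_op_def[abs_def] shift by simp
qed

end

lemma generator_eqI:
  assumes "(f, g) \<in> generator_graph M X"
  shows "generator M X f = g"
  unfolding generator_def
proof (rule the_equality[where P = "\<lambda>g. (f, g) \<in> generator_graph M X"])
  fix h assume "(f, h) \<in> generator_graph M X"
  with assms have "((\<lambda>t. (semigroup_op M X t f x - f x) / t) \<longlongrightarrow> h x) (at_right 0)"
    "((\<lambda>t. (semigroup_op M X t f x - f x) / t) \<longlongrightarrow> g x) (at_right 0)" for x
    by (auto simp: generator_graph_def intro: tendsto_uniform_limitI)
  then show "h = g" by (intro ext tendsto_unique[OF trivial_limit_at_right_real])
qed fact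

lemma C0_2_imp_compact_C2:
  assumes f: "f \<in> C0_2" and s: "compact_support f"
  shows "\<exists>R. compact_C2 f (deriv f) (deriv (deriv f)) R"
proof -
  from s obtain R where R: "\<And>x. f x \<noteq> 0 \<Longrightarrow> \<bar>x\<bar> \<le> R"
    unfolding compact_support_def
    by (metis (mono_tags, lifting) bounded_real closure_subset compact_imp_bounded mem_Collect_eq subsetD)
  have "compact_C2 f (deriv f) (deriv (deriv f)) (max R 1)"
  proof
    show "(f has_real_derivative deriv f x) (at x)" "(deriv f has_real_derivative deriv (deriv f) x) (at x)" for x
      using f by (auto simp: C0_2_def intro!: field_differentiable_derivI)
    show "isCont (deriv (deriv f)) x" for x
      using f by (auto simp: C0_2_def C0_def continuous_on_eq_continuous_at)
    show "f x = 0" if "\<bar>x\<bar> > max R 1" for x using R[of x] that by auto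
  qed simp
  then show ?thesis ..
qed

text \<open>The derivative of \<open>\<nu>\<close> at \<open>0\<close> may have any sign, so it is replaced by \<open>0\<close> there.\<close>

lemma levy_function_imp_levy_triplet:
  assumes "levy_function \<nu>" and "A \<ge> 0"
  shows "levy_triplet A (\<lambda>y. if y = 0 then 0 else deriv \<nu> y)"
proof
  let ?w = "\<lambda>y. if y = 0 then 0 else deriv \<nu> y"
  let ?g = "\<lambda>x. x\<^sup>2 / (1 + x\<^sup>2) * deriv \<nu> x"
  have g: "integrable lborel ?g" using assms by (simp add: levy_function_def)
  then have [measurable]: "?g \<in> borel_measurable borel" by simp
  have eq: "?w = (\<lambda>y. ?g y * ((1 + y\<^sup>2) / y\<^sup>2))"
  proof
    fix y :: real
    have "1 + y\<^sup>2 \<noteq> 0" by (smt (verit) zero_le_power2)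
    then show "?w y = ?g y * ((1 + y\<^sup>2) / y\<^sup>2)" by (cases "y = 0") auto
  qed
  show m [measurable]: "?w \<in> borel_measurable borel" unfolding eq by measurable
  show w0: "?w y \<ge> 0" for y using assms by (auto simp: levy_function_def)
  show "integrable lborel (\<lambda>y. min 1 (y\<^sup>2) * ?w y)"
  proof (rule Bochner_Integration.integrable_bound)
    show "integrable lborel (\<lambda>y. 2 * ?g y)" by (rule integrable_mult_right[OF g])
    show "AE y in lborel. norm (min 1 (y\<^sup>2) * ?w y) \<le> norm (2 * ?g y)"
    proof (intro AE_I2)
      fix y :: real
      have "min 1 (y\<^sup>2) \<le> 2 * (y\<^sup>2 / (1 + y\<^sup>2))"
      proof (cases "y\<^sup>2 \<le> 1")
        case True
        then have "y\<^sup>2 * y\<^sup>2 \<le> y\<^sup>2 * 1" by (intro mult_left_mono) auto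
        then show ?thesis using True by (simp add: min_absorb2 field_simps add_pos_nonneg)
      next
        case False
        then show ?thesis by (simp add: min_absorb1 field_simps add_pos_nonneg)
      qed
      then have "min 1 (y\<^sup>2) * ?w y \<le> 2 * (y\<^sup>2 / (1 + y\<^sup>2)) * ?w y"
        using w0 by (rule mult_right_mono)
      also have "\<dots> = 2 * ?g y" by simp
      also have "\<dots> \<le> \<bar>2 * ?g y\<bar>" by (rule abs_ge_self)
      finally have "min 1 (y\<^sup>2) * ?w y \<le> \<bar>2 * ?g y\<bar>" .
      moreover have nonneg: "min 1 (y\<^sup>2) * ?w y \<ge> 0" using w0[of y] by (intro mult_nonneg_nonneg) auto
      ultimately show "norm (min 1 (y\<^sup>2) * ?w y) \<le> norm (2 * ?g y)"
        unfolding real_norm_def abs_of_nonneg[OF nonneg] by blast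
    qed
  qed simp
qed fact

theorem proposition2p1:
  fixes M :: "'a measure" and X :: "real \<Rightarrow> 'a \<Rightarrow> real"
    and A \<gamma> C \<alpha> :: real and \<nu> :: "real \<Rightarrow> real"
  assumes "levy_process M X"
    and "has_levy_characteristics M X A \<gamma> \<nu>"
    and "C > 0" and "0 < \<alpha>" and "\<alpha> < 2" and "\<alpha> \<noteq> 1"
    and "\<And>y. y \<noteq> 0 \<Longrightarrow> deriv \<nu> y \<le> C * \<bar>y\<bar> powr (- \<alpha> - 1)"
  shows "\<exists>k :: real \<Rightarrow> real.
    (\<forall>N>0. set_integrable lborel {-N..N} k) \<and>
    (\<forall>f \<in> C0_2. compact_support f \<longrightarrow>
       f \<in> Domain (generator_graph M X) \<and>
       (\<forall>x. (conv_op A k (deriv f) has_real_derivative generator M X f x) (at x)))"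
proof -
  from assms(1) interpret prob_space M by (simp add: levy_process_def)
  have X: "random_variable borel (X t)" if "t > 0" for t
    using assms(1) that by (simp add: levy_process_def)
  define w where "w y = (if y = 0 then 0 else deriv \<nu> y)" for y
  define \<mu> where "\<mu> t = distr M borel (X t)" for t
  interpret levy_triplet A \<gamma> w
    using levy_function_imp_levy_triplet[of \<nu> A] assms(2)
    by (simp add: has_levy_characteristics_def w_def[abs_def])
  have exponent: "levy_exponent A \<gamma> \<nu> z = exponent z" for z
  proof -
    have "(iexp (y * z) - 1 - \<i> * of_real (y * z * indicator {-1..1} y)) * of_real (deriv \<nu> y) = w y *\<^sub>R compensated_iexp z y" for y
      by (cases "y = 0") (simp_all add: compensated_iexp_def w_def scaleR_conv_of_real mult.commute)
    then show ?thesis unfolding levy_exponent_def exponent_def by simp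
  qed
  interpret levy_semigroup A \<gamma> w \<mu>
  proof (intro levy_semigroup.intro levy_semigroup_axioms.intro levy_triplet_axioms)
    show "real_distribution (\<mu> t)" if "t > 0" for t
      unfolding \<mu>_def using X[OF that] by simp
    show "char (\<mu> t) z = exp (- of_real t * exponent z)" if t: "t > 0" for t z
      using assms(2) t X[OF t]
      by (simp add: char_def \<mu>_def integral_distr has_levy_characteristics_def exponent)
  qed
  have "f \<in> Domain (generator_graph M X) \<and>
      (\<forall>x. (conv_op A k (deriv f) has_real_derivative generator M X f x) (at x))"
    if f: "f \<in> C0_2" "compact_support f" for f
  proof -
    obtain R where "compact_C2 f (deriv f) (deriv (deriv f)) R"
      using C0_2_imp_compact_C2[OF f] by blast
    then interpret F: compact_C2 f "deriv f" "deriv (deriv f)" R .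
    interpret G: levy_generator A \<gamma> w \<mu> f "deriv f" "deriv (deriv f)" R ..
    have "uniform_limit UNIV (\<lambda>t x. (semigroup_op M X t f x - f x) / t) G.L (at_right 0)"
    proof (rule uniform_limit_cong[THEN iffD1, OF _ _ G.difference_quotient_uniform_limit])
      show "\<forall>\<^sub>F t in at_right 0. \<forall>x\<in>UNIV. ((LINT y|\<mu> t. f (x + y)) - f x) / t = (semigroup_op M X t f x - f x) / t"
        unfolding eventually_at_right_field
        using X by (intro exI[of _ 1]) (auto simp: semigroup_op_def \<mu>_def integral_distr)
    qed simp
    then have graph: "(f, G.L) \<in> generator_graph M X"
      using f(1) G.L_C0 by (simp add: generator_graph_def C0_2_def)
    then show ?thesis
      using G.conv_op_has_derivative generator_eqI[OF graph] by auto
  qed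
  with k_locally_integrable show ?thesis by blast
qed

end
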